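(* Let $\mathcal{P},\mathcal{S},\mathcal{P}'$ be TRSs such that $\mathcal{S}$ is left-linear, $\mathcal{P}$ is reversible, $\mathcal{P}' \subseteq \mathcal{P}\cup\mathcal{P}^{-1}$, and $\mathcal{S}$ is terminating relative to $\mathcal{P}'$. Suppose (i) $\mathrm{CP}(\mathcal{S},\mathcal{S}) \subseteq {\stackrel{*}{\to}}_{\mathcal{S}\cup\mathcal{P}'} \circ {\leftleftarrows}_{\mathcal{P}\cup\mathcal{P}^{-1}} \circ {\stackrel{*}{\gets}}_{\mathcal{S}\cup\mathcal{P}'}$, (ii) $\mathrm{CP}_{in}(\mathcal{P}\cup\mathcal{P}^{-1},\mathcal{S}) = \emptyset$, and (iii) $\mathrm{CP}(\mathcal{S},\mathcal{P}\cup\mathcal{P}^{-1}) \subseteq ({\stackrel{*}{\to}}_{\mathcal{S}\cup\mathcal{P}'} \circ {\rightrightarrows}_{\mathcal{P}\cup\mathcal{P}^{-1}}) \cup ({\stackrel{*}{\to}}_{\mathcal{S}\cup\mathcal{P}'} \circ {\rightrightarrows}_{\mathcal{P}\cup\mathcal{P}^{-1}} \circ {\stackrel{*}{\gets}}_{\mathcal{S}\cup\mathcal{P}'} \circ {\gets}_{\mathcal{S}})$. Then $\mathcal{S}\cup\mathcal{P}$ is confluent.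
   Context: Terms are built from a signature of fixed-arity function symbols and a set of variables; $\mathcal{V}(t)$ is the set of variables of $t$; positions are sequences of positive integers, $t/p$ is the subterm at $p$, $t[s]_p$ the replacement; positions are parallel if neither is a prefix of the other. A substitution maps variables to terms (finite domain), extended homomorphically; $t\sigma$ is its application. A rewrite rule $l\to r$ has $l$ not a variable and $\mathcal{V}(r)\subseteq\mathcal{V}(l)$; a TRS is a finite set of rewrite rules; $s\to_{\mathcal{R}} t$ iff $s/p=l\sigma$, $t=s[r\sigma]_p$ for some rule $l\to r\in\mathcal{R}$, position $p$, substitution $\sigma$. $\mathcal{R}^{-1}=\{r\to l\mid l\to r\in\mathcal{R}\}$. A TRS is left-linear if no variable occurs twice in any left-hand side. $\mathcal{R}$ is reversible if $s\to_{\mathcal{R}}t$ implies $t\stackrel{*}{\to}_{\mathcal{R}}s$; confluent if ${\stackrel{*}{\gets}}\circ{\stackrel{*}{\to}}\subseteq{\stackrel{*}{\to}}\circ{\stackrel{*}{\gets}}$. $\mathcal{S}$ is terminating relative to $\mathcal{P}'$ if ${\to_{\mathcal{S}}}\circ{\stackrel{*}{\to}_{\mathcal{P}'}}$ admits no infinite chain. Parallel rewriting: $s\rightrightarrows_{\mathcal{R}} t$ iff there are pairwise parallel positions $p_1,\dots,p_n$ in $s$ ($n\ge0$), rules $l_i\to r_i\in\mathcal{R}$ and substitutions $\theta_i$ with $s/p_i=l_i\theta_i$ and $t$ obtained from $s$ by replacing each $s/p_i$ by $r_i\theta_i$ (so $\rightrightarrows_{\mathcal{R}}$ is reflexive); $\leftleftarrows$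 is its inverse. Critical pairs: for rules $l_1\to r_1\in\mathcal{R}$, $l_2\to r_2\in\mathcal{Q}$ with disjoint variables and a non-variable position $p$ of $l_2$ with $l_1$, $l_2/p$ unifiable with mgu $\sigma$ (excluding $p=\epsilon$ when the rules are the same up to renaming), $\langle l_2[r_1]_p\sigma, r_2\sigma\rangle$ is a critical pair; $\mathrm{CP}(\mathcal{R},\mathcal{Q})$ is the set of these; $\mathrm{CP}_{in}(\mathcal{R},\mathcal{Q})$ is the subset with $p\neq\epsilon$. For a set $C$ of pairs and a relation $R$, $C\subseteq R$ means $u\,R\,v$ for all $\langle u,v\rangle\in C$. Relation notation: reversed arrows are inverses, $\stackrel{*}{}$ reflexive-transitive closure, $\circ$ composition ($a\,(R\circ S)\,c$ iff $\exists b$, $a\,R\,b$, $b\,S\,c$). *)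

theory Defs
  imports Main "HOL-Library.Sublist"
begin

section \<open>Terms over a signature\<close>

datatype (funs_term: 'f, vars_term: 'v) "term" =
  Var 'v | Fun 'f "('f, 'v) term list"

text \<open>The signature consists of the elements of \<open>'f\<close>, each with its fixed arity
  \<open>ar f\<close>. The datatype itself does not bound the number of arguments; the terms of the
  signature are the ones satisfying \<open>wf_term ar\<close>.\<close>

fun wf_term :: "('f \<Rightarrow> nat) \<Rightarrow> ('f, 'v) term \<Rightarrow> bool" where
  "wf_term ar (Var x) = True"
| "wf_term ar (Fun f ts) = (length ts = ar f \<and> (\<forall>t \<in> set ts. wf_term ar t))"

type_synonym pos = "nat list"

text \<open>Argument positions are counted from 1.\<close>

lemma size_nth_term_less [termination_simp]:
  "i < length ts \<Longrightarrow> size (ts ! i) < Suc (size_list size ts)"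
  using size_list_estimation'[of "ts ! i" ts "size (ts ! i)" size] by simp

declare conj_cong [fundef_cong]

fun poss :: "('f, 'v) term \<Rightarrow> pos set" where
  "poss (Var x) = {[]}"
| "poss (Fun f ts) = insert [] {Suc i # p | i p. i < length ts \<and> p \<in> poss (ts ! i)}"

declare conj_cong [fundef_cong del]

text \<open>Only meaningful for \<open>p \<in> poss t\<close>.\<close>

fun subterm_at :: "('f, 'v) term \<Rightarrow> pos \<Rightarrow> ('f, 'v) term" where
  "subterm_at t [] = t"
| "subterm_at (Fun f ts) (Suc i # p) = subterm_at (ts ! i) p"

fun replace_at :: "('f, 'v) term \<Rightarrow> pos \<Rightarrow> ('f, 'v) term \<Rightarrow> ('f, 'v) term" where
  "replace_at t [] u = u"
| "replace_at (Fun f ts) (Suc i # p) u = Fun f (ts[i := replace_at (ts ! i) p u])"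

definition linear_term :: "('f, 'v) term \<Rightarrow> bool" where
  "linear_term t \<longleftrightarrow> (\<forall>x. \<forall>p \<in> poss t. \<forall>q \<in> poss t.
     subterm_at t p = Var x \<longrightarrow> subterm_at t q = Var x \<longrightarrow> p = q)"

section \<open>Substitutions\<close>

definition is_subst :: "('f \<Rightarrow> nat) \<Rightarrow> ('v \<Rightarrow> ('f, 'v) term) \<Rightarrow> bool" where
  "is_subst ar \<sigma> \<longleftrightarrow> finite {x. \<sigma> x \<noteq> Var x} \<and> (\<forall>x. wf_term ar (\<sigma> x))"

primrec apply_subst :: "('f, 'v) term \<Rightarrow> ('v \<Rightarrow> ('f, 'v) term) \<Rightarrow> ('f, 'v) term"
    (infixl "\<cdot>" 67) where
  "Var x \<cdot> \<sigma> = \<sigma> x"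
| "Fun f ts \<cdot> \<sigma> = Fun f (map (\<lambda>t. t \<cdot> \<sigma>) ts)"

definition is_mgu ::
  "('f \<Rightarrow> nat) \<Rightarrow> ('v \<Rightarrow> ('f, 'v) term) \<Rightarrow> ('f, 'v) term \<Rightarrow> ('f, 'v) term \<Rightarrow> bool" where
  "is_mgu ar \<sigma> s t \<longleftrightarrow> is_subst ar \<sigma> \<and> s \<cdot> \<sigma> = t \<cdot> \<sigma> \<and>
     (\<forall>\<tau>. is_subst ar \<tau> \<and> s \<cdot> \<tau> = t \<cdot> \<tau> \<longrightarrow>
        (\<exists>\<delta>. is_subst ar \<delta> \<and> (\<forall>x. \<tau> x = \<sigma> x \<cdot> \<delta>)))"

section \<open>Rewriting\<close>

type_synonym ('f, 'v) rule = "('f, 'v) term \<times> ('f, 'v) term"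

definition is_trs :: "('f \<Rightarrow> nat) \<Rightarrow> ('f, 'v) rule set \<Rightarrow> bool" where
  "is_trs ar R \<longleftrightarrow> finite R \<and> (\<forall>(l, r) \<in> R. wf_term ar l \<and> wf_term ar r \<and>
     (\<forall>x. l \<noteq> Var x) \<and> vars_term r \<subseteq> vars_term l)"

definition left_linear :: "('f, 'v) rule set \<Rightarrow> bool" where
  "left_linear R \<longleftrightarrow> (\<forall>(l, r) \<in> R. linear_term l)"

text \<open>The rewrite relations are defined for arbitrary sets of pairs of terms, so that they
  also apply to \<open>R\<inverse>\<close>, which is just the relational converse.\<close>

definition rstep :: "('f \<Rightarrow> nat) \<Rightarrow> ('f, 'v) rule set \<Rightarrow> ('f, 'v) term rel" where
  "rstep ar R = {(s, t). wf_term ar s \<and>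
     (\<exists>l r p \<sigma>. (l, r) \<in> R \<and> p \<in> poss s \<and> is_subst ar \<sigma> \<and>
        subterm_at s p = l \<cdot> \<sigma> \<and> t = replace_at s p (r \<cdot> \<sigma>))}"

text \<open>The order in which the replacements are carried out is irrelevant, because the positions
  are pairwise parallel.\<close>

definition par_rstep :: "('f \<Rightarrow> nat) \<Rightarrow> ('f, 'v) rule set \<Rightarrow> ('f, 'v) term rel" where
  "par_rstep ar R = {(s, t). wf_term ar s \<and>
     (\<exists>(n :: nat) p l r \<theta>.
        (\<forall>i<n. p i \<in> poss s \<and> (l i, r i) \<in> R \<and> is_subst ar (\<theta> i) \<and>
           subterm_at s (p i) = l i \<cdot> \<theta> i) \<and>
        (\<forall>i<n. \<forall>j<n. i \<noteq> j \<longrightarrow> parallel (p i) (p j)) \<and>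
        t = fold (\<lambda>i u. replace_at u (p i) (r i \<cdot> \<theta> i)) [0..<n] s)}"

definition reversible :: "('f \<Rightarrow> nat) \<Rightarrow> ('f, 'v) rule set \<Rightarrow> bool" where
  "reversible ar R \<longleftrightarrow> (\<forall>s t. (s, t) \<in> rstep ar R \<longrightarrow> (t, s) \<in> (rstep ar R)\<^sup>*)"

definition confluent :: "('f \<Rightarrow> nat) \<Rightarrow> ('f, 'v) rule set \<Rightarrow> bool" where
  "confluent ar R \<longleftrightarrow>
     ((rstep ar R)\<^sup>*)\<inverse> O (rstep ar R)\<^sup>* \<subseteq> (rstep ar R)\<^sup>* O ((rstep ar R)\<^sup>*)\<inverse>"

definition terminating_relative ::
  "('f \<Rightarrow> nat) \<Rightarrow> ('f, 'v) rule set \<Rightarrow> ('f, 'v) rule set \<Rightarrow> bool" where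
  "terminating_relative ar S Q \<longleftrightarrow>
     \<not> (\<exists>t :: nat \<Rightarrow> ('f, 'v) term. \<forall>i. (t i, t (Suc i)) \<in> rstep ar S O (rstep ar Q)\<^sup>*)"

section \<open>Critical pairs\<close>

definition is_variant :: "('f, 'v) rule \<Rightarrow> ('f, 'v) rule \<Rightarrow> bool" where
  "is_variant \<rho> \<rho>' \<longleftrightarrow> (\<exists>\<pi> :: 'v \<Rightarrow> 'v. bij \<pi> \<and>
     fst \<rho>' = map_term id \<pi> (fst \<rho>) \<and> snd \<rho>' = map_term id \<pi> (snd \<rho>))"

text \<open>\<open>CP_at ar R Q p\<close> collects the critical pairs whose overlap is at position \<open>p\<close> of
  the left-hand side of (a variant of) a rule of \<open>Q\<close>. All variable-disjoint variants of the
  two rules and all most general unifiers are admitted, so the set is closed under renaming of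
  variables.\<close>

definition CP_at ::
  "('f \<Rightarrow> nat) \<Rightarrow> ('f, 'v) rule set \<Rightarrow> ('f, 'v) rule set \<Rightarrow> pos \<Rightarrow> ('f, 'v) term rel" where
  "CP_at ar R Q p =
     {(replace_at l\<^sub>2 p r\<^sub>1 \<cdot> \<sigma>, r\<^sub>2 \<cdot> \<sigma>) | l\<^sub>1 r\<^sub>1 l\<^sub>2 r\<^sub>2 \<sigma>.
        (\<exists>\<rho> \<in> R. is_variant \<rho> (l\<^sub>1, r\<^sub>1)) \<and> (\<exists>\<rho> \<in> Q. is_variant \<rho> (l\<^sub>2, r\<^sub>2)) \<and>
        (vars_term l\<^sub>1 \<union> vars_term r\<^sub>1) \<inter> (vars_term l\<^sub>2 \<union> vars_term r\<^sub>2) = {} \<and>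
        p \<in> poss l\<^sub>2 \<and> (\<forall>x. subterm_at l\<^sub>2 p \<noteq> Var x) \<and>
        is_mgu ar \<sigma> l\<^sub>1 (subterm_at l\<^sub>2 p) \<and>
        \<not> (p = [] \<and> is_variant (l\<^sub>1, r\<^sub>1) (l\<^sub>2, r\<^sub>2))}"

definition CP ::
  "('f \<Rightarrow> nat) \<Rightarrow> ('f, 'v) rule set \<Rightarrow> ('f, 'v) rule set \<Rightarrow> ('f, 'v) term rel" where
  "CP ar R Q = (\<Union>p. CP_at ar R Q p)"

definition CP_in ::
  "('f \<Rightarrow> nat) \<Rightarrow> ('f, 'v) rule set \<Rightarrow> ('f, 'v) rule set \<Rightarrow> ('f, 'v) term rel" where
  "CP_in ar R Q = (\<Union>p \<in> {p. p \<noteq> []}. CP_at ar R Q p)"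

end

theory Submission
  imports Defs "HOL-Library.Multiset"
begin

text \<open>
  Let \<open>H\<close> be the rewrite relation of \<open>S\<close> and \<open>V\<close> the parallel rewrite relation of \<open>P \<union> P\<inverse>\<close>, which
  is symmetric. Every conversion between \<open>H\<close> and \<open>V\<close> is transformed into one of the shape
  \<open>H\<^sup>* O V\<^sup>* O (H\<inverse>)\<^sup>*\<close> by eliminating its peaks; reversibility of \<open>P\<close> turns \<open>V\<^sup>*\<close> into rewriting
  with \<open>P\<close>. A \<open>P'\<close>-step is simply regarded as a \<open>V\<close>-step. To see that the elimination
  terminates, an \<open>H\<close>-step from \<open>s\<close> gets the weight \<open>{(s, 0)}\<close> and a \<open>V\<close>-step between \<open>s\<close> and \<open>t\<close>
  the weight \<open>{(s, 1), (t, 1)}\<close>, where terms are ordered by rewriting with \<open>S \<union> P'\<close> using at least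
  one \<open>S\<close>-step. A peak \<open>u \<leftarrow> s V v\<close> is replaced by a conversion whose weight
  consists of elements below \<open>s\<close>, elements below \<open>v\<close>, and at most one of \<open>(v, 0)\<close> and \<open>(v, 1)\<close>, so
  the multiset of all weights decreases.

  Variable overlaps of an \<open>S\<close>-step below a \<open>P\<close>-redex are harmless without left-linearity of \<open>P\<close>,
  since the remaining copies can be rewritten as well and, by reversibility, the two sides of a rule
  of \<open>P\<close> have the same variables. Left-linearity of \<open>S\<close> and \<open>CP\<^sub>i\<^sub>n(P \<union> P\<inverse>, S) = \<emptyset>\<close> take care of
  parallel \<open>P\<close>-steps below an \<open>S\<close>-redex.
\<close>

section \<open>Substitutions and positions\<close>

lemma apply_subst_eq_iff: "t \<cdot> \<sigma> = t \<cdot> \<tau> \<longleftrightarrow> (\<forall>x \<in> vars_term t. \<sigma> x = \<tau> x)"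
  by (induction t) auto

lemma apply_subst_Var [simp]: "t \<cdot> Var = t"
  by (induction t) (auto simp: map_idI)

lemma apply_subst_assoc: "t \<cdot> \<sigma> \<cdot> \<tau> = t \<cdot> (\<lambda>x. \<sigma> x \<cdot> \<tau>)"
  by (induction t) auto

lemma map_term_eq_apply_subst: "map_term id \<pi> t = t \<cdot> (\<lambda>x. Var (\<pi> x))"
  by (induction t) auto

lemma vars_term_apply_subst: "vars_term (t \<cdot> \<sigma>) = (\<Union>x \<in> vars_term t. vars_term (\<sigma> x))"
  by (induction t) auto

lemma finite_vars_term [simp]: "finite (vars_term t)"
  by (induction t) auto

lemma wf_term_apply_subst:
  "wf_term ar (t \<cdot> \<sigma>) \<longleftrightarrow> wf_term ar t \<and> (\<forall>x \<in> vars_term t. wf_term ar (\<sigma> x))"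
  by (induction t) auto

lemma is_subst_Var [simp]: "is_subst ar Var"
  by (simp add: is_subst_def)

lemma is_substD: "is_subst ar \<sigma> \<Longrightarrow> wf_term ar (\<sigma> x)"
  by (simp add: is_subst_def)

text \<open>Substitutions patched together from others must keep a finite domain; altering one on a
  finite set of variables is harmless. All later substitutions defined by cases are checked this
  way.\<close>

lemma is_subst_finite_change:
  assumes "is_subst ar \<sigma>" "finite A" "\<And>x. x \<notin> A \<Longrightarrow> \<tau> x = \<sigma> x" "\<And>x. wf_term ar (\<tau> x)"
  shows "is_subst ar \<tau>"
proof -
  have "{x. \<tau> x \<noteq> Var x} \<subseteq> A \<union> {x. \<sigma> x \<noteq> Var x}"
    using assms(3) by force
  then show ?thesis
    using assms unfolding is_subst_def by (simp add: finite_subset)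
qed

lemma is_subst_upd: "is_subst ar \<sigma> \<Longrightarrow> wf_term ar t \<Longrightarrow> is_subst ar (\<sigma>(x := t))"
  by (rule is_subst_finite_change[where A = "{x}"]) (auto simp: is_substD)

lemma is_subst_comp:
  assumes "is_subst ar \<sigma>" "is_subst ar \<tau>"
  shows "is_subst ar (\<lambda>x. \<sigma> x \<cdot> \<tau>)"
  by (rule is_subst_finite_change[where A = "{x. \<sigma> x \<noteq> Var x}", OF assms(2)])
    (use assms in \<open>auto simp: is_subst_def wf_term_apply_subst\<close>)

section \<open>Positions, subterms and replacement\<close>

lemma Cons_in_poss_Fun [simp]:
  "k # p \<in> poss (Fun f ts) \<longleftrightarrow> (\<exists>i. k = Suc i \<and> i < length ts \<and> p \<in> poss (ts ! i))"
  by auto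

lemma Nil_in_poss [simp]: "[] \<in> poss t"
  by (cases t) auto

lemma Cons_in_poss_iff:
  "k # p \<in> poss t \<longleftrightarrow>
    (\<exists>f ts i. t = Fun f ts \<and> k = Suc i \<and> i < length ts \<and> p \<in> poss (ts ! i))"
  by (cases t) auto

declare poss.simps(2) [simp del]

lemma poss_apply_subst: "p \<in> poss t \<Longrightarrow> p \<in> poss (t \<cdot> \<sigma>)"
  by (induction p arbitrary: t) (auto simp: Cons_in_poss_iff)

lemma subterm_at_apply_subst:
  "p \<in> poss t \<Longrightarrow> subterm_at (t \<cdot> \<sigma>) p = subterm_at t p \<cdot> \<sigma>"
  by (induction p arbitrary: t) (auto simp: Cons_in_poss_iff)

lemma replace_at_apply_subst:
  "p \<in> poss t \<Longrightarrow> replace_at t p u \<cdot> \<sigma> = replace_at (t \<cdot> \<sigma>) p (u \<cdot> \<sigma>)"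
  by (induction p arbitrary: t) (auto simp: Cons_in_poss_iff map_update)

lemma wf_term_subterm_at: "p \<in> poss t \<Longrightarrow> wf_term ar t \<Longrightarrow> wf_term ar (subterm_at t p)"
  by (induction p arbitrary: t) (auto simp: Cons_in_poss_iff)

lemma wf_term_Fun_update:
  "wf_term ar (Fun f ts) \<Longrightarrow> wf_term ar t \<Longrightarrow> wf_term ar (Fun f (ts[i := t]))"
  by (auto dest!: set_update_subset_insert[THEN subsetD])

lemma wf_term_replace_at:
  "p \<in> poss t \<Longrightarrow> wf_term ar t \<Longrightarrow> wf_term ar u \<Longrightarrow> wf_term ar (replace_at t p u)"
  by (induction p arbitrary: t)
    (auto simp: Cons_in_poss_iff simp del: wf_term.simps intro!: wf_term_Fun_update,
      auto)

lemma vars_term_subterm_at: "p \<in> poss t \<Longrightarrow> vars_term (subterm_at t p) \<subseteq> vars_term t"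
  by (induction p arbitrary: t) (fastforce simp: Cons_in_poss_iff)+

lemma vars_term_iff_poss: "x \<in> vars_term t \<longleftrightarrow> (\<exists>p \<in> poss t. subterm_at t p = Var x)"
proof
  show "x \<in> vars_term t \<Longrightarrow> \<exists>p \<in> poss t. subterm_at t p = Var x"
  proof (induction t)
    case (Fun f ts)
    then obtain i p where "i < length ts" "p \<in> poss (ts ! i)" "subterm_at (ts ! i) p = Var x"
      by (auto simp: in_set_conv_nth) (metis nth_mem)
    then show ?case
      by (intro bexI[of _ "Suc i # p"]) auto
  qed auto
next
  show "\<exists>p \<in> poss t. subterm_at t p = Var x \<Longrightarrow> x \<in> vars_term t"
    using vars_term_subterm_at by fastforce
qed

text \<open>Two occurrences in arguments \<open>i\<close> and \<open>j\<close> extend to positions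
  starting with \<open>Suc i\<close> and \<open>Suc j\<close>, which linearity forces to coincide.
  This turns the definition by positions into one usable in structural induction.\<close>

lemma linear_term_Fun:
  assumes "linear_term (Fun f ts)"
  shows "i < length ts \<Longrightarrow> linear_term (ts ! i)"
    and "i < length ts \<Longrightarrow> j < length ts \<Longrightarrow> i \<noteq> j \<Longrightarrow>
      vars_term (ts ! i) \<inter> vars_term (ts ! j) = {}"
proof -
  have *: "i = j \<and> p = q" if "i < length ts" "j < length ts" "p \<in> poss (ts ! i)"
    "q \<in> poss (ts ! j)" "subterm_at (ts ! i) p = Var x" "subterm_at (ts ! j) q = Var x"
    for i j p q x
    using assms that unfolding linear_term_def
    by (metis (mono_tags) Cons_in_poss_Fun Suc_inject list.inject subterm_at.simps(2))
  show "i < length ts \<Longrightarrow> linear_term (ts ! i)"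
    using * unfolding linear_term_def by blast
  show "i < length ts \<Longrightarrow> j < length ts \<Longrightarrow> i \<noteq> j \<Longrightarrow>
      vars_term (ts ! i) \<inter> vars_term (ts ! j) = {}"
    using * by (auto simp: vars_term_iff_poss)
qed

section \<open>Existence of most general unifiers\<close>

definition vars_eqs :: "(('f, 'v) term \<times> ('f, 'v) term) list \<Rightarrow> 'v set" where
  "vars_eqs E = (\<Union>(s, t) \<in> set E. vars_term s \<union> vars_term t)"

definition size_eqs :: "(('f, 'v) term \<times> ('f, 'v) term) list \<Rightarrow> nat" where
  "size_eqs E = (\<Sum>(s, t) \<leftarrow> E. size s + size t)"

definition unifies :: "('v \<Rightarrow> ('f, 'v) term) \<Rightarrow> (('f, 'v) term \<times> ('f, 'v) term) list \<Rightarrow> bool" where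
  "unifies \<sigma> E \<longleftrightarrow> (\<forall>(s, t) \<in> set E. s \<cdot> \<sigma> = t \<cdot> \<sigma>)"

text \<open>The analogue of \<open>is_mgu\<close> for lists of equations: generality is again
  required only against well-formed substitutions with finite domain.\<close>

definition mgu_eqs ::
  "('f \<Rightarrow> nat) \<Rightarrow> ('v \<Rightarrow> ('f, 'v) term) \<Rightarrow> (('f, 'v) term \<times> ('f, 'v) term) list \<Rightarrow> bool" where
  "mgu_eqs ar \<sigma> E \<longleftrightarrow> is_subst ar \<sigma> \<and> unifies \<sigma> E \<and>
     (\<forall>\<tau>. is_subst ar \<tau> \<and> unifies \<tau> E \<longrightarrow>
        (\<exists>\<delta>. is_subst ar \<delta> \<and> (\<forall>x. \<tau> x = \<sigma> x \<cdot> \<delta>)))"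

lemma mgu_eqs_cong:
  assumes "\<And>\<tau>. unifies \<tau> E' \<longleftrightarrow> unifies \<tau> E"
  shows "mgu_eqs ar \<sigma> E' \<longleftrightarrow> mgu_eqs ar \<sigma> E"
  unfolding mgu_eqs_def assms ..

lemma finite_vars_eqs [simp]: "finite (vars_eqs E)"
  unfolding vars_eqs_def by auto

lemma size_apply_subst_ge: "x \<in> vars_term t \<Longrightarrow> size (\<tau> x) \<le> size (t \<cdot> \<tau>)"
proof (induction t)
  case (Fun f ts)
  then obtain t where t: "t \<in> set ts" "x \<in> vars_term t" by auto
  with Fun have "size (\<tau> x) \<le> size (t \<cdot> \<tau>)" by blast
  also have "\<dots> \<le> size_list size (map (\<lambda>t. t \<cdot> \<tau>) ts)"
    using t by (intro size_list_estimation'[of "t \<cdot> \<tau>"]) auto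
  finally show ?case by simp
qed auto

text \<open>Were \<open>t\<close> a function application containing \<open>x\<close>, then
  \<open>\<tau> x\<close> would have a smaller size than \<open>t \<cdot> \<tau>\<close>, which is
  \<open>\<tau> x\<close> itself.\<close>

lemma occurs_check:
  assumes "x \<in> vars_term t" "\<tau> x = t \<cdot> \<tau>"
  shows "t = Var x"
proof (cases t)
  case (Fun f ts)
  then obtain u where u: "u \<in> set ts" "x \<in> vars_term u" using assms by auto
  have "size (\<tau> x) \<le> size (u \<cdot> \<tau>)" by (rule size_apply_subst_ge[OF u(2)])
  also have "\<dots> \<le> size_list size (map (\<lambda>t. t \<cdot> \<tau>) ts)"
    using u by (intro size_list_estimation'[of "u \<cdot> \<tau>"]) auto
  finally show ?thesis using assms Fun by simp
qed (use assms in auto)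

text \<open>Substituting \<open>t\<close> for \<open>x\<close> in the remaining equations removes
  \<open>x\<close>, so the induction hypothesis applies; the result is that substitution followed by
  the unifier obtained. The hypothesis \<open>IH\<close> is passed in explicitly so that both
  orientations of the equation can use it.\<close>

lemma ex_mgu_eqs_eliminate:
  assumes IH: "\<And>E' :: (('f, 'v) term \<times> ('f, 'v) term) list.
      card (vars_eqs E') < card (vars_eqs ((Var x, t) # E)) \<Longrightarrow>
      \<forall>(s, t) \<in> set E'. wf_term ar s \<and> wf_term ar t \<Longrightarrow> unifies \<tau> E' \<Longrightarrow> \<exists>\<sigma>. mgu_eqs ar \<sigma> E'"
    and wf: "wf_term ar t" "\<forall>(s, t) \<in> set E. wf_term ar s \<and> wf_term ar t"
    and u: "unifies \<tau> ((Var x, t) # E)" and ne: "t \<noteq> Var x"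
  shows "\<exists>\<sigma>. mgu_eqs ar \<sigma> ((Var x, t) # E)"
proof -
  define \<theta> where "\<theta> = Var(x := t)"
  define E' where "E' = map (\<lambda>(s, t). (s \<cdot> \<theta>, t \<cdot> \<theta>)) E"
  have xt: "x \<notin> vars_term t"
    using occurs_check[of x t \<tau>] u ne by (auto simp: unifies_def)
  have \<theta>: "is_subst ar \<theta>"
    unfolding \<theta>_def using wf by (simp add: is_subst_upd)
  \<comment> \<open>A unifier of the first equation already identifies \<open>x\<close> with
    \<open>t\<close>, so applying \<open>\<theta>\<close> before it changes nothing.\<close>
  have absorb: "(\<lambda>y. \<theta> y \<cdot> \<rho>) = \<rho>" if "unifies \<rho> ((Var x, t) # E)" for \<rho>
    using that by (auto simp: unifies_def \<theta>_def)
  have E': "unifies \<rho> E' \<longleftrightarrow> unifies (\<lambda>y. \<theta> y \<cdot> \<rho>) E" for \<rho>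
    unfolding unifies_def E'_def by (auto simp: apply_subst_assoc)
  have "vars_term (s \<cdot> \<theta>) \<subseteq> (vars_term s \<union> vars_term t) - {x}" for s
    unfolding vars_term_apply_subst \<theta>_def using xt by (auto split: if_splits)
  then have "vars_eqs E' \<subseteq> vars_eqs ((Var x, t) # E) - {x}"
    unfolding vars_eqs_def E'_def by fastforce
  moreover have "x \<in> vars_eqs ((Var x, t) # E)"
    by (simp add: vars_eqs_def)
  ultimately have "card (vars_eqs E') < card (vars_eqs ((Var x, t) # E))"
    by (intro psubset_card_mono) auto
  moreover have "\<forall>(s, t) \<in> set E'. wf_term ar s \<and> wf_term ar t"
    using wf \<theta> unfolding E'_def by (auto simp: wf_term_apply_subst is_substD)
  moreover have "unifies \<tau> E'"
    unfolding E' absorb[OF u] using u by (simp add: unifies_def)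
  ultimately obtain \<sigma> where \<sigma>: "mgu_eqs ar \<sigma> E'"
    using IH by blast
  have "\<theta> y \<cdot> \<sigma> = (if y = x then t \<cdot> \<sigma> else \<sigma> y)" for y
    by (simp add: \<theta>_def)
  moreover have "t \<cdot> (\<lambda>y. \<theta> y \<cdot> \<sigma>) = t \<cdot> \<sigma>"
    using xt by (auto simp: apply_subst_eq_iff \<theta>_def)
  ultimately have "unifies (\<lambda>y. \<theta> y \<cdot> \<sigma>) ((Var x, t) # E)"
    using \<sigma> E' unfolding mgu_eqs_def unifies_def by auto
  moreover have "\<exists>\<delta>. is_subst ar \<delta> \<and> (\<forall>y. \<rho> y = \<theta> y \<cdot> \<sigma> \<cdot> \<delta>)"
    if \<rho>: "is_subst ar \<rho>" "unifies \<rho> ((Var x, t) # E)" for \<rho>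
  proof -
    have "unifies \<rho> E'"
      unfolding E' absorb[OF \<rho>(2)] using \<rho> by (simp add: unifies_def)
    then obtain \<delta> where \<delta>: "is_subst ar \<delta>" "\<And>y. \<rho> y = \<sigma> y \<cdot> \<delta>"
      using \<sigma> \<rho> unfolding mgu_eqs_def by blast
    then have "(\<lambda>y. \<sigma> y \<cdot> \<delta>) = \<rho>" by auto
    then have "\<theta> y \<cdot> \<sigma> \<cdot> \<delta> = \<rho> y" for y
      using fun_cong[OF absorb[OF \<rho>(2)], of y] by (simp add: apply_subst_assoc)
    with \<delta> show ?thesis by metis
  qed
  moreover have "is_subst ar (\<lambda>y. \<theta> y \<cdot> \<sigma>)"
    using \<theta> \<sigma> unfolding mgu_eqs_def by (blast intro: is_subst_comp)
  ultimately show ?thesis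
    unfolding mgu_eqs_def by blast
qed

text \<open>Induction on the number of variables and then the total size: elimination lowers the
  first, while deletion and decomposition lower the second without raising the first. The given
  unifier \<open>\<tau>\<close> excludes symbol clashes and cyclic equations.\<close>

lemma ex_mgu_eqs:
  assumes "\<forall>(s, t) \<in> set E. wf_term ar s \<and> wf_term ar t" "unifies \<tau> E"
  shows "\<exists>\<sigma>. mgu_eqs ar \<sigma> E"
  using assms
proof (induction E rule: wf_induct[OF wf_measures[of "[\<lambda>E. card (vars_eqs E), size_eqs]"]])
  case (1 E)
  note IH = 1(1)[rule_format] and wf = 1(2) and u = 1(3)
  show ?case
  proof (cases E)
    case Nil
    then show ?thesis
      by (intro exI[of _ Var]) (auto simp: mgu_eqs_def unifies_def)
  next
    case (Cons e E')
    obtain s t where e: "e = (s, t)" by force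
    note E = Cons[unfolded e]
    have wfE': "\<forall>(s, t) \<in> set E'. wf_term ar s \<and> wf_term ar t" using wf E by auto
    show ?thesis
    proof (cases "s = t")
      case True
      have "vars_eqs E' \<subseteq> vars_eqs E" by (auto simp: vars_eqs_def E)
      then have "card (vars_eqs E') \<le> card (vars_eqs E)" by (intro card_mono) auto
      moreover have "size_eqs E' < size_eqs E"
        by (cases s) (simp_all add: size_eqs_def E True)
      ultimately have "\<exists>\<sigma>. mgu_eqs ar \<sigma> E'"
        using wf u by (intro IH) (auto simp: E unifies_def)
      then show ?thesis
        using mgu_eqs_cong[of E E' ar] by (simp add: E True unifies_def)
    next
      case ne: False
      show ?thesis
      proof (cases s)
        case (Var x)
        show ?thesis
          unfolding E Var
          by (rule ex_mgu_eqs_eliminate[where \<tau> = \<tau>])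
            (use IH wf u ne in \<open>auto simp: E Var\<close>)
      next
        case s: (Fun f ss)
        show ?thesis
        proof (cases t)
          case (Var x)
          \<comment> \<open>The equation is turned around so that its variable stands on the left;
            variables and unifiers of the system stay the same.\<close>
          have "\<exists>\<sigma>. mgu_eqs ar \<sigma> ((t, s) # E')"
            unfolding Var
          proof (rule ex_mgu_eqs_eliminate[where \<tau> = \<tau>])
            fix E'' :: "(('a, 'b) term \<times> ('a, 'b) term) list"
            assume *: "card (vars_eqs E'') < card (vars_eqs ((Var x, s) # E'))"
              "\<forall>(s, t) \<in> set E''. wf_term ar s \<and> wf_term ar t" "unifies \<tau> E''"
            have "vars_eqs ((Var x, s) # E') = vars_eqs E"
              by (auto simp: vars_eqs_def E Var)
            with * show "\<exists>\<sigma>. mgu_eqs ar \<sigma> E''"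
              by (intro IH) auto
          qed (use wf u ne in \<open>auto simp: E Var unifies_def\<close>)
          moreover have "mgu_eqs ar \<sigma> ((t, s) # E') \<longleftrightarrow> mgu_eqs ar \<sigma> E" for \<sigma>
            by (rule mgu_eqs_cong) (auto simp: E unifies_def)
          ultimately show ?thesis by simp
        next
          case t: (Fun g ts)
          have fg: "f = g" and m: "map (\<lambda>t. t \<cdot> \<tau>) ss = map (\<lambda>t. t \<cdot> \<tau>) ts"
            using u by (auto simp: E s t unifies_def)
          then have len: "length ss = length ts" by (metis length_map)
          have zip: "unifies \<rho> (zip ss ts) \<longleftrightarrow> Fun f ss \<cdot> \<rho> = Fun g ts \<cdot> \<rho>" for \<rho>
            unfolding fg unifies_def using len
            by (auto simp: list_eq_iff_nth_eq in_set_zip)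
          have eq: "unifies \<rho> E \<longleftrightarrow> unifies \<rho> (zip ss ts @ E')" for \<rho>
            using zip[of \<rho>] by (auto simp: E s t unifies_def)
          have "vars_eqs (zip ss ts @ E') \<subseteq> vars_eqs E"
            by (auto simp: vars_eqs_def E s t) (metis in_set_zipE)+
          then have "card (vars_eqs (zip ss ts @ E')) \<le> card (vars_eqs E)"
            by (intro card_mono) auto
          moreover have "(\<Sum>(s, t) \<leftarrow> zip ss ts. size s + size t) \<le> size_list size ss + size_list size ts"
            using len by (induction ss ts rule: list_induct2) auto
          then have "size_eqs (zip ss ts @ E') < size_eqs E"
            by (simp add: size_eqs_def E s t)
          moreover have "\<forall>(s, t) \<in> set (zip ss ts @ E'). wf_term ar s \<and> wf_term ar t"
            using wf by (auto simp: E s t dest: set_zip_leftD set_zip_rightD)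
          ultimately have "\<exists>\<sigma>. mgu_eqs ar \<sigma> (zip ss ts @ E')"
            using u eq by (intro IH) auto
          then show ?thesis
            using mgu_eqs_cong[of E "zip ss ts @ E'" ar] eq by simp
        qed
      qed
    qed
  qed
qed

lemma ex_is_mgu:
  assumes "wf_term ar s" "wf_term ar t" "s \<cdot> \<tau> = t \<cdot> \<tau>"
  shows "\<exists>\<sigma>. is_mgu ar \<sigma> s t"
  using ex_mgu_eqs[of "[(s, t)]" ar \<tau>] assms
  by (auto simp: is_mgu_def mgu_eqs_def unifies_def)

section \<open>Rewriting\<close>

text \<open>Unlike \<open>is_trs\<close>, this is closed under converse, as needed for
  \<open>P \<union> P\<inverse>\<close>.\<close>

definition wf_rules :: "('f \<Rightarrow> nat) \<Rightarrow> ('f, 'v) rule set \<Rightarrow> bool" where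
  "wf_rules ar R \<longleftrightarrow> (\<forall>(l, r) \<in> R. wf_term ar l \<and> wf_term ar r)"

lemma wf_rulesD: "wf_rules ar R \<Longrightarrow> (l, r) \<in> R \<Longrightarrow> wf_term ar l \<and> wf_term ar r"
  by (auto simp: wf_rules_def)

lemma is_trs_wf_rules: "is_trs ar R \<Longrightarrow> wf_rules ar R"
  by (auto simp: is_trs_def wf_rules_def)

lemma wf_rules_Un: "wf_rules ar R \<Longrightarrow> wf_rules ar Q \<Longrightarrow> wf_rules ar (R \<union> Q)"
  by (auto simp: wf_rules_def)

lemma wf_rules_converse: "wf_rules ar R \<Longrightarrow> wf_rules ar (R\<inverse>)"
  by (auto simp: wf_rules_def)

lemma rstep_root:
  assumes "(l, r) \<in> R" "is_subst ar \<sigma>" "wf_term ar (l \<cdot> \<sigma>)"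
  shows "(l \<cdot> \<sigma>, r \<cdot> \<sigma>) \<in> rstep ar R"
proof -
  have "[] \<in> poss (l \<cdot> \<sigma>) \<and> subterm_at (l \<cdot> \<sigma>) [] = l \<cdot> \<sigma> \<and>
      r \<cdot> \<sigma> = replace_at (l \<cdot> \<sigma>) [] (r \<cdot> \<sigma>)"
    by simp
  with assms show ?thesis unfolding rstep_def by blast
qed

lemma rstep_arg:
  assumes "(ss ! i, t) \<in> rstep ar R" "i < length ss" "wf_term ar (Fun f ss)"
  shows "(Fun f ss, Fun f (ss[i := t])) \<in> rstep ar R"
proof -
  obtain l r p \<sigma> where *: "(l, r) \<in> R" "p \<in> poss (ss ! i)" "is_subst ar \<sigma>"
    "subterm_at (ss ! i) p = l \<cdot> \<sigma>" "t = replace_at (ss ! i) p (r \<cdot> \<sigma>)"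
    using assms(1) unfolding rstep_def by blast
  then have "Suc i # p \<in> poss (Fun f ss) \<and> subterm_at (Fun f ss) (Suc i # p) = l \<cdot> \<sigma> \<and>
      Fun f (ss[i := t]) = replace_at (Fun f ss) (Suc i # p) (r \<cdot> \<sigma>)"
    using assms(2) by simp
  with * assms(3) show ?thesis unfolding rstep_def by blast
qed

text \<open>Splitting on whether the redex position is empty replaces reasoning about positions by
  structural recursion.\<close>

lemma rstep_cases [consumes 1, case_names root arg]:
  assumes "(s, t) \<in> rstep ar R"
  obtains l r \<sigma> where "(l, r) \<in> R" "is_subst ar \<sigma>" "s = l \<cdot> \<sigma>" "t = r \<cdot> \<sigma>"
  | f ss i u where "s = Fun f ss" "i < length ss" "(ss ! i, u) \<in> rstep ar R"
      "t = Fun f (ss[i := u])"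
proof -
  obtain l r p \<sigma> where *: "wf_term ar s" "(l, r) \<in> R" "p \<in> poss s" "is_subst ar \<sigma>"
    "subterm_at s p = l \<cdot> \<sigma>" "t = replace_at s p (r \<cdot> \<sigma>)"
    using assms unfolding rstep_def by blast
  show ?thesis
  proof (cases p)
    case Nil
    with * that(1) show ?thesis by auto
  next
    case (Cons k q)
    with * obtain f ss i where s: "s = Fun f ss" "k = Suc i" "i < length ss" "q \<in> poss (ss ! i)"
      by (auto simp: Cons_in_poss_iff)
    with * Cons have "(ss ! i, replace_at (ss ! i) q (r \<cdot> \<sigma>)) \<in> rstep ar R"
      unfolding rstep_def by auto
    with that(2) s * Cons show ?thesis by auto
  qed
qed

lemma rstep_mono: "R \<subseteq> Q \<Longrightarrow> rstep ar R \<subseteq> rstep ar Q"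
  unfolding rstep_def by blast

lemma rstep_Un: "rstep ar (R \<union> Q) = rstep ar R \<union> rstep ar Q"
  unfolding rstep_def by blast

lemma rstep_wf_left: "(s, t) \<in> rstep ar R \<Longrightarrow> wf_term ar s"
  by (auto simp: rstep_def)

lemma rstep_wf_right: "(s, t) \<in> rstep ar R \<Longrightarrow> wf_rules ar R \<Longrightarrow> wf_term ar t"
  unfolding rstep_def
  by (auto intro!: wf_term_replace_at simp: wf_term_apply_subst is_substD dest: wf_rulesD)

lemma rsteps_wf: "(s, t) \<in> (rstep ar R)\<^sup>* \<Longrightarrow> wf_rules ar R \<Longrightarrow> wf_term ar s \<Longrightarrow> wf_term ar t"
  by (induction rule: rtrancl_induct) (auto dest: rstep_wf_right)

section \<open>Closure of rewriting under substitutions and contexts\<close>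

lemma rstep_apply_subst:
  assumes "(s, t) \<in> rstep ar R" "is_subst ar \<delta>"
  shows "(s \<cdot> \<delta>, t \<cdot> \<delta>) \<in> rstep ar R"
proof -
  obtain l r p \<sigma> where *: "wf_term ar s" "(l, r) \<in> R" "p \<in> poss s" "is_subst ar \<sigma>"
    "subterm_at s p = l \<cdot> \<sigma>" "t = replace_at s p (r \<cdot> \<sigma>)"
    using assms(1) unfolding rstep_def by blast
  let ?\<sigma> = "\<lambda>x. \<sigma> x \<cdot> \<delta>"
  have "wf_term ar (s \<cdot> \<delta>) \<and> p \<in> poss (s \<cdot> \<delta>) \<and> is_subst ar ?\<sigma> \<and>
      subterm_at (s \<cdot> \<delta>) p = l \<cdot> ?\<sigma> \<and> t \<cdot> \<delta> = replace_at (s \<cdot> \<delta>) p (r \<cdot> ?\<sigma>)"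
    using * assms(2)
    by (auto simp: wf_term_apply_subst is_substD poss_apply_subst is_subst_comp
        subterm_at_apply_subst replace_at_apply_subst apply_subst_assoc)
  with * show ?thesis unfolding rstep_def by blast
qed

lemma rsteps_apply_subst:
  "(s, t) \<in> (rstep ar R)\<^sup>* \<Longrightarrow> is_subst ar \<delta> \<Longrightarrow> (s \<cdot> \<delta>, t \<cdot> \<delta>) \<in> (rstep ar R)\<^sup>*"
  by (induction rule: rtrancl_induct) (auto intro: rstep_apply_subst rtrancl_into_rtrancl)

lemma rsteps_arg:
  assumes "(s, t) \<in> (rstep ar R)\<^sup>*" "wf_rules ar R" "i < length ss" "wf_term ar (Fun f (ss[i := s]))"
  shows "(Fun f (ss[i := s]), Fun f (ss[i := t])) \<in> (rstep ar R)\<^sup>*"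
  using assms(1)
proof (induction rule: rtrancl_induct)
  case (step t u)
  have "wf_term ar t" using step(2) by (rule rstep_wf_left)
  then have "wf_term ar (Fun f (ss[i := s, i := t]))"
    using assms(4) by (rule wf_term_Fun_update[rotated])
  then have "(Fun f (ss[i := t]), Fun f (ss[i := t, i := u])) \<in> rstep ar R"
    using step(2) assms(3) by (intro rstep_arg) simp_all
  with step(3) show ?case by simp
qed simp

lemma rsteps_args:
  assumes "\<And>i. i < ar f \<Longrightarrow> (ss ! i, ts ! i) \<in> (rstep ar R)\<^sup>*" "wf_rules ar R"
    and "length ss = ar f" "length ts = ar f" "wf_term ar (Fun f ss)"
  shows "(Fun f ss, Fun f ts) \<in> (rstep ar R)\<^sup>*"
proof -
  \<comment> \<open>The arguments are rewritten from left to right; after \<open>k\<close> rounds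
    the first \<open>k\<close> of them are final.\<close>
  have "(Fun f ss, Fun f (take k ts @ drop k ss)) \<in> (rstep ar R)\<^sup>*" if "k \<le> ar f" for k
    using that
  proof (induction k)
    case (Suc k)
    let ?us = "take k ts @ drop k ss"
    have "(Fun f ss, Fun f ?us) \<in> (rstep ar R)\<^sup>*" using Suc by simp
    moreover have "?us = ?us[k := ss ! k]" "take (Suc k) ts @ drop (Suc k) ss = ?us[k := ts ! k]"
      using assms(3,4) Suc(2)
      by (auto simp: list_eq_iff_nth_eq nth_append nth_list_update less_Suc_eq)
    moreover have "(Fun f (?us[k := ss ! k]), Fun f (?us[k := ts ! k])) \<in> (rstep ar R)\<^sup>*"
    proof (rule rsteps_arg)
      show "(ss ! k, ts ! k) \<in> (rstep ar R)\<^sup>*" "k < length ?us"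
        using assms Suc(2) by auto
      show "wf_term ar (Fun f (?us[k := ss ! k]))"
        using rsteps_wf[OF calculation(1) assms(2,5)] calculation(2) by argo
    qed (rule assms(2))
    ultimately show ?case by (metis rtrancl_trans)
  qed simp
  from this[of "ar f"] show ?thesis using assms by simp
qed

lemma rsteps_subst:
  assumes "\<And>x. x \<in> vars_term t \<Longrightarrow> (\<sigma> x, \<tau> x) \<in> (rstep ar R)\<^sup>*" "wf_rules ar R"
    and "wf_term ar (t \<cdot> \<sigma>)"
  shows "(t \<cdot> \<sigma>, t \<cdot> \<tau>) \<in> (rstep ar R)\<^sup>*"
  using assms
proof (induction t)
  case (Fun f ts)
  show ?case
    unfolding apply_subst.simps
  proof (rule rsteps_args)
    fix i assume "i < ar f"
    then have "ts ! i \<in> set ts" using Fun(4) by simp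
    then have "(ts ! i \<cdot> \<sigma>, ts ! i \<cdot> \<tau>) \<in> (rstep ar R)\<^sup>*"
      using Fun(2-4) by (intro Fun(1)) (auto intro: Fun(2))
    with \<open>i < ar f\<close> show "(map (\<lambda>t. t \<cdot> \<sigma>) ts ! i, map (\<lambda>t. t \<cdot> \<tau>) ts ! i) \<in> (rstep ar R)\<^sup>*"
      using Fun(4) by simp
  qed (use Fun(3,4) in auto)
qed auto

text \<open>The side condition on the rules passes to their instances and then to contexts;
  \<open>reversible_vars\<close> applies this along a whole reduction.\<close>

lemma rstep_vars:
  assumes "(s, t) \<in> rstep ar R" "\<forall>(l, r) \<in> R. vars_term r \<subseteq> vars_term l"
  shows "vars_term t \<subseteq> vars_term s"
proof -
  have vars: "vars_term (r \<cdot> \<sigma>) \<subseteq> vars_term (l \<cdot> \<sigma>)" if "(l, r) \<in> R" for l r \<sigma>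
    using assms(2) that unfolding vars_term_apply_subst by blast
  show ?thesis
    using assms(1)
  proof (induction s arbitrary: t)
    case (Var x)
    then show ?case
      by (cases rule: rstep_cases) (metis vars, simp)
  next
    case (Fun f ss)
    from Fun(2) show ?case
    proof (cases rule: rstep_cases)
      case (root l r \<sigma>)
      then show ?thesis using vars by metis
    next
      case (arg g ss' i u)
      then have "vars_term u \<subseteq> vars_term (ss ! i)" using Fun(1)[of "ss ! i" u] by simp
      moreover have "vars_term (ss ! i) \<subseteq> vars_term (Fun f ss)"
        using arg by (auto intro: nth_mem)
      ultimately show ?thesis
        using arg by (auto dest!: set_update_subset_insert[THEN subsetD])
    qed
  qed
qed

section \<open>Parallel rewriting\<close>

text \<open>Parallel rewriting without positions: a parallel step is empty, contracts the root, or
  acts on all arguments at once. \<open>par_rstep_subset_par\<close> links it to the relation in the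
  critical pair conditions.\<close>

inductive_set par :: "('f \<Rightarrow> nat) \<Rightarrow> ('f, 'v) rule set \<Rightarrow> ('f, 'v) term rel"
  for ar :: "'f \<Rightarrow> nat" and R :: "('f, 'v) rule set" where
  par_refl: "wf_term ar s \<Longrightarrow> (s, s) \<in> par ar R"
| par_root: "(l, r) \<in> R \<Longrightarrow> is_subst ar \<sigma> \<Longrightarrow> wf_term ar (l \<cdot> \<sigma>) \<Longrightarrow> (l \<cdot> \<sigma>, r \<cdot> \<sigma>) \<in> par ar R"
| par_args: "length ss = ar f \<Longrightarrow> length ts = ar f \<Longrightarrow>
    (\<And>i. i < ar f \<Longrightarrow> (ss ! i, ts ! i) \<in> par ar R) \<Longrightarrow> (Fun f ss, Fun f ts) \<in> par ar R"

lemma par_wf_left: "(s, t) \<in> par ar R \<Longrightarrow> wf_term ar s"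
  by (induction rule: par.induct) (auto simp: in_set_conv_nth)

lemma par_wf_right: "(s, t) \<in> par ar R \<Longrightarrow> wf_rules ar R \<Longrightarrow> wf_term ar t"
  by (induction rule: par.induct)
    (auto simp: in_set_conv_nth wf_term_apply_subst is_substD dest: wf_rulesD)

lemma sym_par:
  assumes "wf_rules ar R" "sym R"
  shows "sym (par ar R)"
proof (rule symI)
  show "(t, s) \<in> par ar R" if "(s, t) \<in> par ar R" for s t
    using that
  proof (induction rule: par.induct)
    case (par_root l r \<sigma>)
    then show ?case
      using assms wf_rulesD[OF assms(1), of r l]
      by (intro par.par_root) (auto simp: wf_term_apply_subst is_substD dest: symD)
  qed (auto intro: par.intros)
qed

lemma par_apply_subst: "(s, t) \<in> par ar R \<Longrightarrow> is_subst ar \<delta> \<Longrightarrow> (s \<cdot> \<delta>, t \<cdot> \<delta>) \<in> par ar R"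
proof (induction rule: par.induct)
  case (par_root l r \<sigma>)
  then show ?case
    using par.par_root[of l r R ar "\<lambda>x. \<sigma> x \<cdot> \<delta>"] is_subst_comp[of ar \<sigma> \<delta>]
    by (auto simp: apply_subst_assoc wf_term_apply_subst is_substD)
next
  case (par_args ss f ts)
  then show ?case by (auto intro!: par.par_args)
qed (auto intro!: par_refl simp: wf_term_apply_subst is_substD)

lemma par_subst:
  assumes "\<And>x. x \<in> vars_term t \<Longrightarrow> (\<sigma> x, \<tau> x) \<in> par ar R" "wf_term ar t"
  shows "(t \<cdot> \<sigma>, t \<cdot> \<tau>) \<in> par ar R"
  using assms
proof (induction t)
  case (Fun f ts)
  have "(ts ! i \<cdot> \<sigma>, ts ! i \<cdot> \<tau>) \<in> par ar R" if "i < length ts" for i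
    using nth_mem[OF that] Fun by (auto intro!: Fun(1) intro: Fun(2))
  with Fun(3) show ?case by (auto intro!: par_args)
qed simp

lemma rstep_subset_par: "rstep ar R \<subseteq> par ar R"
proof (rule subrelI)
  show "(s, t) \<in> par ar R" if "(s, t) \<in> rstep ar R" for s t
    using that
  proof (induction s arbitrary: t)
    case (Var x)
    then show ?case
      by (cases rule: rstep_cases) (metis par_root rstep_wf_left Var, simp)
  next
    case (Fun f ss)
    have wf: "wf_term ar (Fun f ss)" using Fun(2) by (rule rstep_wf_left)
    from Fun(2) show ?case
    proof (cases rule: rstep_cases)
      case (root l r \<sigma>)
      with wf show ?thesis by (metis par_root)
    next
      case (arg g ss' i u)
      with Fun(1) wf show ?thesis
        by (auto intro!: par_args simp: nth_list_update par_refl)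
    qed
  qed
qed

lemma par_subset_rsteps: "wf_rules ar R \<Longrightarrow> par ar R \<subseteq> (rstep ar R)\<^sup>*"
proof (rule subrelI)
  show "(s, t) \<in> (rstep ar R)\<^sup>*" if "(s, t) \<in> par ar R" "wf_rules ar R" for s t
    using that
  proof (induction rule: par.induct)
    case (par_args ss f ts)
    have "wf_term ar (Fun f ss)"
      using par_args par_wf_left by (fastforce simp: in_set_conv_nth)
    with par_args show ?case by (intro rsteps_args) auto
  qed (auto intro: rstep_root)
qed

text \<open>Replacements below different arguments do not interfere, so a sequence of them splits
  into one sequence per argument, in the original order.\<close>

lemma fold_replace_at_Fun:
  assumes "\<And>p u. (p, u) \<in> set L \<Longrightarrow> \<exists>i q. p = Suc i # q \<and> i < length ss"
  shows "fold (\<lambda>(p, u) t. replace_at t p u) L (Fun f ss) =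
    Fun f (map (\<lambda>i. fold (\<lambda>(p, u) t. replace_at t p u)
      (map (\<lambda>(p, u). (tl p, u)) (filter (\<lambda>(p, u). hd p = Suc i) L)) (ss ! i)) [0..<length ss])"
  using assms
proof (induction L arbitrary: ss)
  case Nil
  then show ?case by (simp add: map_nth)
next
  case (Cons a L)
  obtain i q u where a: "a = (Suc i # q, u)" "i < length ss"
    using Cons(2)[of "fst a" "snd a"] by (cases a) auto
  let ?ss = "ss[i := replace_at (ss ! i) q u]"
  have IH: "fold (\<lambda>(p, u) t. replace_at t p u) L (Fun f ?ss) =
    Fun f (map (\<lambda>i. fold (\<lambda>(p, u) t. replace_at t p u)
      (map (\<lambda>(p, u). (tl p, u)) (filter (\<lambda>(p, u). hd p = Suc i) L)) (?ss ! i)) [0..<length ?ss])"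
  proof (rule Cons(1))
    fix p v assume "(p, v) \<in> set L"
    then show "\<exists>i q. p = Suc i # q \<and> i < length ?ss"
      using Cons(2)[of p v] by simp
  qed
  show ?case
    using a by (simp add: IH)
qed

text \<open>Induction on the term. The root position is a prefix of every position, so if it occurs,
  it is the only one and the step is a root step; otherwise the list is distributed over the
  arguments. Distinctness is assumed separately because the condition on parallel positions says
  nothing about repeated entries.\<close>

lemma par_fold:
  assumes "wf_term ar s"
    and "\<And>p u. (p, u) \<in> set L \<Longrightarrow> p \<in> poss s \<and>
      (\<exists>l r \<sigma>. (l, r) \<in> R \<and> is_subst ar \<sigma> \<and> subterm_at s p = l \<cdot> \<sigma> \<and> u = r \<cdot> \<sigma>)"
    and "distinct (map fst L)"
    and "\<And>p q. p \<in> fst ` set L \<Longrightarrow> q \<in> fst ` set L \<Longrightarrow> p \<noteq> q \<Longrightarrow> parallel p q"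
  shows "(s, fold (\<lambda>(p, u) t. replace_at t p u) L s) \<in> par ar R"
  using assms
proof (induction s arbitrary: L)
  case (Var x)
  show ?case
  proof (cases L)
    case Nil
    then show ?thesis by (simp add: par_refl)
  next
    case (Cons a L')
    obtain u where a: "a = ([], u)" using Var(2)[of "fst a" "snd a"] Cons by (cases a) auto
    have "L' = []"
    proof (cases L')
      case (Cons b L'')
      then have "parallel [] (fst b)" using Var(3) Var(4)[of "[]" "fst b"] \<open>L = a # L'\<close> a by auto
      then show ?thesis by (auto simp: parallel_def)
    qed
    moreover obtain l r \<sigma> where "(l, r) \<in> R" "is_subst ar \<sigma>" "Var x = l \<cdot> \<sigma>" "u = r \<cdot> \<sigma>"
      using Var(2)[of "[]" u] Cons a by auto
    ultimately show ?thesis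
      using Var(1) par_root[of l r R ar \<sigma>] Cons a by simp
  qed
next
  case (Fun f ss)
  show ?case
  proof (cases "[] \<in> fst ` set L")
    case True
    have "fst ` set L \<subseteq> {[]}"
      using Fun(5)[OF True] by (auto simp: parallel_def)
    then have "length L \<le> 1"
      using Fun(4) by (metis card_mono card.empty card_insert_if distinct_card empty_iff
          finite.emptyI finite.insertI length_map list.set_map One_nat_def)
    with True obtain u where "L = [([], u)]" by (cases L) auto
    moreover from this obtain l r \<sigma>
      where "(l, r) \<in> R" "is_subst ar \<sigma>" "Fun f ss = l \<cdot> \<sigma>" "u = r \<cdot> \<sigma>"
      using Fun(3)[of "[]" u] by auto
    ultimately show ?thesis
      using Fun(2) par_root[of l r R ar \<sigma>] by simp
  next
    case False
    have L: "\<exists>i q. p = Suc i # q \<and> i < length ss \<and> q \<in> poss (ss ! i)" if "(p, u) \<in> set L" for p u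
      using Fun(3)[OF that] that False by (cases p) force+
    let ?L = "\<lambda>i. map (\<lambda>(p, u). (tl p, u)) (filter (\<lambda>(p, u). hd p = Suc i) L)"
    have mem: "(q, u) \<in> set (?L i) \<longleftrightarrow> (Suc i # q, u) \<in> set L" for q u i
      using L by force
    have "(ss ! i, fold (\<lambda>(p, u) t. replace_at t p u) (?L i) (ss ! i)) \<in> par ar R"
      if i: "i < length ss" for i
    proof (rule Fun(1))
      show "ss ! i \<in> set ss" "wf_term ar (ss ! i)" using i Fun(2) by auto
      show "q \<in> poss (ss ! i) \<and> (\<exists>l r \<sigma>. (l, r) \<in> R \<and> is_subst ar \<sigma> \<and>
          subterm_at (ss ! i) q = l \<cdot> \<sigma> \<and> u = r \<cdot> \<sigma>)" if "(q, u) \<in> set (?L i)" for q u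
        using that Fun(3)[of "Suc i # q" u] unfolding mem by simp
      have "map fst (?L i) = map tl (filter (\<lambda>p. hd p = Suc i) (map fst L))"
        by (induction L) auto
      moreover have "inj_on tl {p \<in> fst ` set L. hd p = Suc i}"
      proof (rule inj_onI)
        fix p q assume "p \<in> {p \<in> fst ` set L. hd p = Suc i}" "q \<in> {p \<in> fst ` set L. hd p = Suc i}"
          "tl p = tl q"
        moreover from this obtain u v where "(p, u) \<in> set L" "(q, v) \<in> set L"
          by auto
        ultimately show "p = q" using L[of p u] L[of q v] by auto
      qed
      ultimately show "distinct (map fst (?L i))"
        using Fun(4) by (simp add: distinct_map)
      show "parallel p q" if *: "p \<in> fst ` set (?L i)" "q \<in> fst ` set (?L i)" "p \<noteq> q" for p q
      proof -
        obtain u v where "(p, u) \<in> set (?L i)" "(q, v) \<in> set (?L i)"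
          using *(1,2) unfolding image_iff by (metis prod.collapse)
        then have "(Suc i # p, u) \<in> set L" "(Suc i # q, v) \<in> set L"
          unfolding mem .
        then have "parallel (Suc i # p) (Suc i # q)"
          using * Fun(5)[of "Suc i # p" "Suc i # q"] by force
        then show ?thesis by (auto simp: parallel_def)
      qed
    qed
    with Fun(2) show ?thesis
      using L by (subst fold_replace_at_Fun) (auto intro!: par_args, blast)
  qed
qed

lemma par_rstep_subset_par: "par_rstep ar R \<subseteq> par ar R"
proof (rule subrelI)
  fix s t assume "(s, t) \<in> par_rstep ar R"
  then obtain n p l r \<theta> where *: "wf_term ar s"
    "\<forall>i<n. p i \<in> poss s \<and> (l i, r i) \<in> R \<and> is_subst ar (\<theta> i) \<and> subterm_at s (p i) = l i \<cdot> \<theta> i"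
    "\<forall>i<n. \<forall>j<n. i \<noteq> j \<longrightarrow> parallel (p i) (p j)"
    "t = fold (\<lambda>i u. replace_at u (p i) (r i \<cdot> \<theta> i)) [0..<n] s"
    unfolding par_rstep_def by blast
  let ?L = "map (\<lambda>i. (p i, r i \<cdot> \<theta> i)) [0..<n]"
  have "(s, fold (\<lambda>(p, u) t. replace_at t p u) ?L s) \<in> par ar R"
  proof (rule par_fold)
    have "inj_on p {0..<n}" using *(3) by (fastforce simp: inj_on_def parallel_def)
    then show "distinct (map fst ?L)" by (simp add: distinct_map comp_def)
    show "q \<in> poss s \<and> (\<exists>l r \<sigma>. (l, r) \<in> R \<and> is_subst ar \<sigma> \<and> subterm_at s q = l \<cdot> \<sigma> \<and> u = r \<cdot> \<sigma>)"
      if "(q, u) \<in> set ?L" for q u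
      using that *(2) by auto blast
    show "parallel q q'" if "q \<in> fst ` set ?L" "q' \<in> fst ` set ?L" "q \<noteq> q'" for q q'
      using that *(3) by auto metis
  qed (rule *(1))
  then show "(s, t) \<in> par ar R"
    by (simp add: *(4) fold_map comp_def)
qed

section \<open>An abstract criterion for Church-Rosser modulo\<close>

datatype 'a link = Fwd 'a 'a | Equ 'a 'a | Bwd 'a 'a

fun conv :: "'a rel \<Rightarrow> 'a rel \<Rightarrow> 'a \<Rightarrow> 'a link list \<Rightarrow> 'a \<Rightarrow> bool" where
  "conv H V x [] z \<longleftrightarrow> x = z"
| "conv H V x (Fwd s t # xs) z \<longleftrightarrow> x = s \<and> (s, t) \<in> H \<and> conv H V t xs z"
| "conv H V x (Equ s t # xs) z \<longleftrightarrow> x = s \<and> (s, t) \<in> V \<and> conv H V t xs z"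
| "conv H V x (Bwd s t # xs) z \<longleftrightarrow> x = s \<and> (t, s) \<in> H \<and> conv H V t xs z"

text \<open>The tags are compared when the terms agree: \<open>(t, 0)\<close> lies below
  \<open>(t, 1)\<close>, so a link of \<open>V\<close> ending in \<open>t\<close> may be traded for
  an \<open>H\<close>-step out of \<open>t\<close>.\<close>

fun weight :: "'a link \<Rightarrow> ('a \<times> nat) multiset" where
  "weight (Fwd s t) = {#(s, 0)#}"
| "weight (Equ s t) = {#(s, 1), (t, 1)#}"
| "weight (Bwd s t) = {#(t, 0)#}"

definition weights :: "'a link list \<Rightarrow> ('a \<times> nat) multiset" where
  "weights xs = (\<Sum>a \<leftarrow> xs. weight a)"

lemma weights_simps [simp]:
  "weights [] = {#}" "weights (a # xs) = weight a + weights xs"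
  "weights (xs @ ys) = weights xs + weights ys"
  by (simp_all add: weights_def)

text \<open>The peaks of a conversion are exactly the descents of \<open>kind\<close>.\<close>

fun kind :: "'a link \<Rightarrow> nat" where
  "kind (Fwd s t) = 0"
| "kind (Equ s t) = 1"
| "kind (Bwd s t) = 2"

fun flip :: "'a link \<Rightarrow> 'a link" where
  "flip (Fwd s t) = Bwd t s"
| "flip (Equ s t) = Equ t s"
| "flip (Bwd s t) = Fwd t s"

lemma weight_flip [simp]: "weight (flip a) = weight a"
  by (cases a) (auto simp: add_mset_commute)

lemma weights_rev_flip [simp]: "weights (rev (map flip xs)) = weights xs"
  by (induction xs) auto

lemma conv_append [simp]: "conv H V x (xs @ ys) z \<longleftrightarrow> (\<exists>y. conv H V x xs y \<and> conv H V y ys z)"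
  by (induction H V x xs z rule: conv.induct) auto

lemma conv_rev_flip: "sym V \<Longrightarrow> conv H V x xs z \<Longrightarrow> conv H V z (rev (map flip xs)) x"
  by (induction H V x xs z rule: conv.induct) (auto dest: symD)

text \<open>Without a descent, all \<open>Fwd\<close> links come first and all \<open>Bwd\<close>
  links last.\<close>

lemma conv_sorted:
  assumes "conv H V x xs z" "sorted (map kind xs)"
  shows "(x, z) \<in> H\<^sup>* O V\<^sup>* O (H\<inverse>)\<^sup>*"
proof -
  \<comment> \<open>The induction also needs the shorter shapes for lists without \<open>Fwd\<close>
    links and for lists of \<open>Bwd\<close> links only.\<close>
  have "conv H V x xs z \<Longrightarrow> sorted (map kind xs) \<Longrightarrow> (x, z) \<in> H\<^sup>* O V\<^sup>* O (H\<inverse>)\<^sup>* \<and>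
    ((\<forall>a \<in> set xs. 1 \<le> kind a) \<longrightarrow> (x, z) \<in> V\<^sup>* O (H\<inverse>)\<^sup>*) \<and>
    ((\<forall>a \<in> set xs. 2 \<le> kind a) \<longrightarrow> (x, z) \<in> (H\<inverse>)\<^sup>*)"
  proof (induction H V x xs z rule: conv.induct)
    case (2 H V x s t xs z)
    then show ?case by (auto intro: converse_rtrancl_into_rtrancl)
  next
    case (3 H V x s t xs z)
    then have "(t, z) \<in> V\<^sup>* O (H\<inverse>)\<^sup>*" "(s, t) \<in> V" "x = s" by auto
    then have "(x, z) \<in> V\<^sup>* O (H\<inverse>)\<^sup>*" by (auto intro: converse_rtrancl_into_rtrancl)
    then show ?case by auto
  next
    case (4 H V x s t xs z)
    then have "(t, z) \<in> (H\<inverse>)\<^sup>*" "(s, t) \<in> H\<inverse>" "x = s" by auto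
    then have "(x, z) \<in> (H\<inverse>)\<^sup>*" by (blast intro: converse_rtrancl_into_rtrancl)
    then show ?case by auto
  qed auto
  with assms show ?thesis by blast
qed

text \<open>The intended instance of \<open>H\<close>, \<open>V\<close> and \<open>Q\<close> is
  rewriting with \<open>S\<close>, parallel rewriting with \<open>P \<union> P\<inverse>\<close>,
  and rewriting with \<open>P'\<close>. The closing \<open>H\<inverse>\<close> in
  \<open>peak_HV\<close> puts everything on that side of the replacement below the end of the
  \<open>V\<close>-link, or at that end with the smaller tag.\<close>

locale church_rosser_modulo =
  fixes H V Q :: "'a rel"
  assumes symV: "sym V" and Q_V: "Q \<subseteq> V"
    and wf: "wf ((H O Q\<^sup>*)\<inverse>)"
    and peak_HH: "H\<inverse> O H \<subseteq> (H \<union> Q)\<^sup>* O V O ((H \<union> Q)\<^sup>*)\<inverse>"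
    and peak_HV: "H\<inverse> O V \<subseteq> ((H \<union> Q)\<^sup>* O V) \<union> ((H \<union> Q)\<^sup>* O V O ((H \<union> Q)\<^sup>*)\<inverse> O H\<inverse>)"
begin

text \<open>A pair \<open>(t, s)\<close> means that \<open>s\<close> reduces to \<open>t\<close> by
  a reduction beginning with an \<open>H\<close>-step; \<open>Q\<close>-steps may follow each
  \<open>H\<close>-step.\<close>

definition lt :: "'a rel" where
  "lt = ((H O Q\<^sup>*)\<inverse>)\<^sup>+"

abbreviation lt2 :: "('a \<times> nat) rel" where
  "lt2 \<equiv> lt <*lex*> less_than"

lemma wf_lt: "wf lt"
  unfolding lt_def using wf by (rule wf_trancl)

lemma trans_lt: "trans lt"
  by (simp add: lt_def)

lemma H_lt: "(s, t) \<in> H \<Longrightarrow> (t, s) \<in> lt"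
  unfolding lt_def by blast

lemma lt_H: "(t, s) \<in> lt \<Longrightarrow> (t, u) \<in> H \<Longrightarrow> (u, s) \<in> lt"
  using trans_lt H_lt by (meson transD)

text \<open>The additional \<open>Q\<close>-step is absorbed into the last block
  \<open>H O Q\<^sup>*\<close> of the descent.\<close>

lemma lt_Q:
  assumes "(t, s) \<in> lt" "(t, u) \<in> Q"
  shows "(u, s) \<in> lt"
proof -
  have *: "(u, a) \<in> (H O Q\<^sup>*)\<inverse>" if "(t, a) \<in> (H O Q\<^sup>*)\<inverse>" for a
    using that assms(2) by (auto intro: rtrancl_into_rtrancl)
  from assms(1) obtain c where "(t, c) \<in> (H O Q\<^sup>*)\<inverse>" "(c, s) \<in> ((H O Q\<^sup>*)\<inverse>)\<^sup>*"
    unfolding lt_def by (meson tranclD)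
  with *[of c] show ?thesis
    unfolding lt_def by (meson rtrancl_into_trancl2)
qed

text \<open>A \<open>Q\<close>-step is taken as a link of \<open>V\<close>; its weight is harmless because both of its ends are
  already below \<open>s\<close>.\<close>

lemma conv_below:
  assumes "(x, z) \<in> (H \<union> Q)\<^sup>*" "(x, s) \<in> lt"
  shows "(z, s) \<in> lt \<and> (\<exists>xs. conv H V x xs z \<and> (\<forall>k \<in># weights xs. (fst k, s) \<in> lt))"
  using assms(1)
proof (induction rule: rtrancl_induct)
  case base
  show ?case using assms(2) by (auto intro: exI[of _ "[]"])
next
  case (step y z)
  then obtain xs where xs: "(y, s) \<in> lt" "conv H V x xs y" "\<forall>k \<in># weights xs. (fst k, s) \<in> lt"
    by blast
  from step(2) show ?case
  proof
    assume "(y, z) \<in> H"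
    with xs show ?thesis
      by (intro conjI exI[of _ "xs @ [Fwd y z]"]) (auto intro: lt_H)
  next
    assume "(y, z) \<in> Q"
    with xs Q_V show ?thesis
      by (intro conjI exI[of _ "xs @ [Equ y z]"]) (auto intro: lt_Q)
  qed
qed

text \<open>The common part \<open>I\<close> is needed because a link of \<open>V\<close> may keep one of its ends.\<close>

definition reduces :: "'a \<Rightarrow> ('a \<times> nat) multiset \<Rightarrow> 'a \<Rightarrow> bool" where
  "reduces x M z \<longleftrightarrow> (\<exists>xs I K J. conv H V x xs z \<and> weights xs = I + K \<and> M = I + J \<and> J \<noteq> {#} \<and>
     (\<forall>k \<in># K. \<exists>j \<in># J. (k, j) \<in> lt2))"

lemma reduces_sym: "reduces x M z \<Longrightarrow> reduces z M x"
  unfolding reduces_def using conv_rev_flip[OF symV] by (metis weights_rev_flip)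

text \<open>Both sides of the peak start with an \<open>H\<close>-step out of \<open>s\<close>, so
  every term in the replacement lies below \<open>s\<close>; nothing is kept.\<close>

lemma reduces_HH:
  assumes "(s, x) \<in> H" "(s, z) \<in> H"
  shows "reduces x {#(s, 0), (s, 0)#} z"
proof -
  obtain u w where u: "(x, u) \<in> (H \<union> Q)\<^sup>*" "(u, w) \<in> V" "(z, w) \<in> (H \<union> Q)\<^sup>*"
    using assms peak_HH by blast
  obtain xs where xs: "(u, s) \<in> lt" "conv H V x xs u" "\<forall>k \<in># weights xs. (fst k, s) \<in> lt"
    using conv_below[OF u(1) H_lt[OF assms(1)]] by blast
  obtain ys where ys: "(w, s) \<in> lt" "conv H V z ys w" "\<forall>k \<in># weights ys. (fst k, s) \<in> lt"
    using conv_below[OF u(3) H_lt[OF assms(2)]] by blast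
  show ?thesis
    unfolding reduces_def
    by (rule exI[of _ "xs @ Equ u w # rev (map flip ys)"], rule exI[of _ "{#}"])
      (use u(2) xs ys conv_rev_flip[OF symV ys(2)] in fastforce)
qed

lemma reduces_HV:
  assumes "(s, x) \<in> H" "(s, z) \<in> V"
  shows "reduces x {#(s, 0), (s, 1), (z, 1)#} z"
proof -
  from assms peak_HV have
    "(x, z) \<in> ((H \<union> Q)\<^sup>* O V) \<union> ((H \<union> Q)\<^sup>* O V O ((H \<union> Q)\<^sup>*)\<inverse> O H\<inverse>)" by blast
  then show ?thesis
  proof
    assume "(x, z) \<in> (H \<union> Q)\<^sup>* O V"
    then obtain u where u: "(x, u) \<in> (H \<union> Q)\<^sup>*" "(u, z) \<in> V" by blast
    obtain xs where xs: "(u, s) \<in> lt" "conv H V x xs u" "\<forall>k \<in># weights xs. (fst k, s) \<in> lt"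
      using conv_below[OF u(1) H_lt[OF assms(1)]] by blast
    show ?thesis
      unfolding reduces_def
      \<comment> \<open>The old and the new link of \<open>V\<close> both end in \<open>z\<close>,
        so \<open>(z, 1)\<close> is the common part; all other new elements lie below
        \<open>s\<close>.\<close>
      by (rule exI[of _ "xs @ [Equ u z]"], rule exI[of _ "{#(z, 1)#}"],
        rule exI[of _ "weights xs + {#(u, 1)#}"], rule exI[of _ "{#(s, 0), (s, 1)#}"])
        (use u(2) xs in fastforce)
  next
    assume "(x, z) \<in> (H \<union> Q)\<^sup>* O V O ((H \<union> Q)\<^sup>*)\<inverse> O H\<inverse>"
    then obtain u w z' where u: "(x, u) \<in> (H \<union> Q)\<^sup>*" "(u, w) \<in> V" "(z', w) \<in> (H \<union> Q)\<^sup>*" "(z, z') \<in> H"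
      by blast
    obtain xs where xs: "(u, s) \<in> lt" "conv H V x xs u" "\<forall>k \<in># weights xs. (fst k, s) \<in> lt"
      using conv_below[OF u(1) H_lt[OF assms(1)]] by blast
    obtain ys where ys: "(w, z) \<in> lt" "conv H V z' ys w" "\<forall>k \<in># weights ys. (fst k, z) \<in> lt"
      using conv_below[OF u(3) H_lt[OF u(4)]] by blast
    show ?thesis
      unfolding reduces_def
      \<comment> \<open>Nothing is kept here: \<open>xs\<close> and \<open>u\<close> lie below
        \<open>s\<close>, \<open>ys\<close> and \<open>w\<close> lie below \<open>z\<close>, and the
        last link contributes \<open>(z, 0)\<close>, which is below \<open>(z, 1)\<close>.\<close>
      by (rule exI[of _ "xs @ Equ u w # rev (map flip ys) @ [Bwd z' z]"], rule exI[of _ "{#}"])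
        (use u(2,4) xs ys conv_rev_flip[OF symV ys(2)] in fastforce)
  qed
qed

text \<open>The descents are \<open>Bwd\<close> before \<open>Fwd\<close>, \<open>Bwd\<close> before
  \<open>Equ\<close>, and \<open>Equ\<close> before \<open>Fwd\<close>; the last is the mirror image
  of the second, since \<open>V\<close> is symmetric.\<close>

lemma reduces_descent:
  assumes "conv H V x [a, b] z" "kind b < kind a"
  shows "reduces x (weight a + weight b) z"
proof (cases a; cases b)
  fix s t s' t' assume "a = Bwd s t" "b = Fwd s' t'"
  with assms show ?thesis using reduces_HH[of t s t'] by auto
next
  fix s t s' t' assume "a = Bwd s t" "b = Equ s' t'"
  with assms show ?thesis using reduces_HV[of t s t'] by (auto simp: add_mset_commute)
next
  fix s t s' t' assume *: "a = Equ s t" "b = Fwd s' t'"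
  with assms have "(t, t') \<in> H" "(t, s) \<in> V" "s' = t" "x = s" "z = t'"
    using symV by (auto dest: symD)
  with * reduces_sym[OF reduces_HV[of t t' s]] show ?thesis
    by (simp add: add_mset_commute)
qed (use assms in auto)

lemma not_sorted_descent:
  "\<not> sorted (map f xs) \<Longrightarrow> \<exists>ys a b zs. xs = ys @ a # b # zs \<and> f b < (f a :: nat)"
proof (induction xs rule: induct_list012)
  case (3 x y zs)
  show ?case
  proof (cases "f y < f x")
    case True
    then show ?thesis by (metis append_Nil)
  next
    case False
    with 3(3) have "\<not> sorted (map f (y # zs))" by (simp only: list.map sorted2) simp
    with 3 show ?thesis by (metis append_Cons)
  qed
qed auto

text \<open>Well-founded induction on the multiset of weights: an unsorted conversion has a descent,
  and replacing it decreases the multiset.\<close>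

lemma conv_normalizes: "conv H V x xs z \<Longrightarrow> (x, z) \<in> H\<^sup>* O V\<^sup>* O (H\<inverse>)\<^sup>*"
proof (induction "weights xs" arbitrary: xs rule: wf_induct_rule[OF wf_mult[of lt2]])
  case 1
  then show ?case using wf_lt by blast
next
  case (2 xs)
  show ?case
  proof (cases "sorted (map kind xs)")
    case True
    with 2 show ?thesis by (simp add: conv_sorted)
  next
    case False
    then obtain ys a b zs where xs: "xs = ys @ [a, b] @ zs" and ab: "kind b < kind a"
      using not_sorted_descent by fastforce
    obtain p q where p: "conv H V x ys p" "conv H V p [a, b] q" "conv H V q zs z"
      using 2(2) unfolding xs conv_append by blast
    obtain xs' I K J where xs': "conv H V p xs' q" "weights xs' = I + K"
      "weight a + weight b = I + J" "J \<noteq> {#}" "\<forall>k \<in># K. \<exists>j \<in># J. (k, j) \<in> lt2"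
      using reduces_descent[OF p(2) ab] unfolding reduces_def by blast
    \<comment> \<open>The weights of the untouched links together with \<open>I\<close> are the
      unchanged part of the multiset comparison.\<close>
    have "((weights ys + weights zs + I) + K, (weights ys + weights zs + I) + J) \<in> mult lt2"
      using xs' by (intro one_step_implies_mult) auto
    moreover have "(weights ys + weights zs + I) + K = weights (ys @ xs' @ zs)"
      using xs' by (simp add: ac_simps)
    moreover have "(weights ys + weights zs + I) + J = weights xs"
      using xs'(3) by (simp add: xs ac_simps)
    ultimately have "(weights (ys @ xs' @ zs), weights xs) \<in> mult lt2"
      by simp
    moreover have "conv H V x (ys @ xs' @ zs) z"
      using p xs' by auto
    ultimately show ?thesis by (rule 2(1))
  qed
qed

theorem church_rosser: "(x, z) \<in> (H \<union> H\<inverse> \<union> V)\<^sup>* \<Longrightarrow> (x, z) \<in> H\<^sup>* O V\<^sup>* O (H\<inverse>)\<^sup>*"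
proof -
  have "\<exists>xs. conv H V x xs z" if "(x, z) \<in> (H \<union> H\<inverse> \<union> V)\<^sup>*"
    using that
  proof (induction rule: rtrancl_induct)
    case base
    show ?case by (auto intro: exI[of _ "[]"])
  next
    case (step y z)
    then obtain xs where xs: "conv H V x xs y" by blast
    consider "(y, z) \<in> H" | "(z, y) \<in> H" | "(y, z) \<in> V" using step(2) by blast
    then show ?case
    proof cases
      case 1
      with xs show ?thesis by (intro exI[of _ "xs @ [Fwd y z]"]) auto
    next
      case 2
      with xs show ?thesis by (intro exI[of _ "xs @ [Bwd y z]"]) auto
    next
      case 3
      with xs show ?thesis by (intro exI[of _ "xs @ [Equ y z]"]) auto
    qed
  qed
  then show "(x, z) \<in> (H \<union> H\<inverse> \<union> V)\<^sup>* \<Longrightarrow> (x, z) \<in> H\<^sup>* O V\<^sup>* O (H\<inverse>)\<^sup>*"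
    using conv_normalizes by blast
qed

end

section \<open>Critical pairs\<close>

text \<open>\<open>A\<close> is exchanged with a set \<open>C\<close> of fresh variables of the same
  cardinality, everything else staying fixed. The renaming is then an involution, hence a bijection
  on all variables as \<open>is_variant\<close> demands.\<close>

lemma ex_renaming_apart:
  assumes "infinite (UNIV :: 'v set)" "finite (A :: 'v set)" "finite B"
  shows "\<exists>\<pi> :: 'v \<Rightarrow> 'v. bij \<pi> \<and> \<pi> ` A \<inter> B = {}"
proof -
  have "infinite (UNIV - (A \<union> B))" using assms by (simp add: Diff_infinite_finite)
  then obtain C where C: "C \<subseteq> UNIV - (A \<union> B)" "finite C" "card C = card A"
    using infinite_arbitrarily_large by metis
  then obtain f where f: "bij_betw f A C"
    using assms(2) finite_same_card_bij by metis
  define \<pi> where "\<pi> x = (if x \<in> A then f x else if x \<in> C then inv_into A f x else x)" for x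
  have fA: "f x \<in> C" "inv_into A f (f x) = x" if "x \<in> A" for x
    using that f by (auto simp: bij_betw_def)
  have fC: "inv_into A f x \<in> A" "f (inv_into A f x) = x" if "x \<in> C" for x
    using that f by (auto simp: bij_betw_def inv_into_into f_inv_into_f)
  have "\<pi> (\<pi> x) = x" for x
    using fA[of x] fC[of x] C(1) by (auto simp: \<pi>_def)
  then have "bij \<pi>" by (metis bijI')
  moreover have "\<pi> ` A \<inter> B = {}" using fA C(1) by (auto simp: \<pi>_def)
  ultimately show ?thesis by blast
qed

lemma is_variant_refl: "is_variant \<rho> \<rho>"
  unfolding is_variant_def by (rule exI[of _ id]) (auto simp: term.map_id)

text \<open>The rule applied inside is renamed apart from the rule applied at the root; the two
  substitutions then combine to a unifier.\<close>

lemma overlap_instance_of_CP: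
  fixes R Q :: "('f, 'v) rule set"
  assumes inf: "infinite (UNIV :: 'v set)"
    and rules: "(l\<^sub>1, r\<^sub>1) \<in> R" "(l\<^sub>2, r\<^sub>2) \<in> Q" "wf_rules ar R" "wf_rules ar Q"
    and vars: "vars_term r\<^sub>1 \<subseteq> vars_term l\<^sub>1"
    and p: "p \<in> poss l\<^sub>2" "\<forall>x. subterm_at l\<^sub>2 p \<noteq> Var x"
    and \<sigma>: "is_subst ar \<sigma>\<^sub>1" "is_subst ar \<sigma>\<^sub>2" "subterm_at l\<^sub>2 p \<cdot> \<sigma>\<^sub>2 = l\<^sub>1 \<cdot> \<sigma>\<^sub>1"
  shows "(p = [] \<and> r\<^sub>1 \<cdot> \<sigma>\<^sub>1 = r\<^sub>2 \<cdot> \<sigma>\<^sub>2) \<or>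
    (\<exists>a b \<delta>. (a, b) \<in> CP_at ar R Q p \<and> is_subst ar \<delta> \<and>
      replace_at (l\<^sub>2 \<cdot> \<sigma>\<^sub>2) p (r\<^sub>1 \<cdot> \<sigma>\<^sub>1) = a \<cdot> \<delta> \<and> r\<^sub>2 \<cdot> \<sigma>\<^sub>2 = b \<cdot> \<delta>)"
proof -
  let ?V1 = "vars_term l\<^sub>1 \<union> vars_term r\<^sub>1" and ?V2 = "vars_term l\<^sub>2 \<union> vars_term r\<^sub>2"
  obtain \<pi> :: "'v \<Rightarrow> 'v" where \<pi>: "bij \<pi>" "\<pi> ` ?V1 \<inter> ?V2 = {}"
    using ex_renaming_apart[OF inf, of ?V1 ?V2] by auto
  define l r where "l = map_term id \<pi> l\<^sub>1" and "r = map_term id \<pi> r\<^sub>1"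
  have lr: "l = l\<^sub>1 \<cdot> (\<lambda>x. Var (\<pi> x))" "r = r\<^sub>1 \<cdot> (\<lambda>x. Var (\<pi> x))"
    by (simp_all add: l_def r_def map_term_eq_apply_subst)
  have vlr: "vars_term l = \<pi> ` vars_term l\<^sub>1" "vars_term r = \<pi> ` vars_term r\<^sub>1"
    by (auto simp: lr vars_term_apply_subst)
  have variant: "is_variant (l\<^sub>1, r\<^sub>1) (l, r)"
    unfolding is_variant_def using \<pi> by (auto simp: l_def r_def)
  \<comment> \<open>\<open>inv \<pi>\<close> undoes the renaming of the first rule; the default
    \<open>Var\<close> keeps the domain finite.\<close>
  define \<tau> where "\<tau> x = (if x \<in> ?V2 then \<sigma>\<^sub>2 x
    else if x \<in> \<pi> ` ?V1 then \<sigma>\<^sub>1 (inv \<pi> x) else Var x)" for x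
  have \<tau>: "is_subst ar \<tau>"
    by (rule is_subst_finite_change[where A = "?V2 \<union> \<pi> ` ?V1" and \<sigma> = Var])
      (use \<sigma> in \<open>auto simp: \<tau>_def is_substD\<close>)
  have \<tau>\<pi>: "\<tau> (\<pi> x) = \<sigma>\<^sub>1 x" if "x \<in> ?V1" for x
    using that \<pi> by (auto simp: \<tau>_def bij_is_inj)
  have l\<tau>: "l \<cdot> \<tau> = l\<^sub>1 \<cdot> \<sigma>\<^sub>1" "r \<cdot> \<tau> = r\<^sub>1 \<cdot> \<sigma>\<^sub>1"
    unfolding lr using \<tau>\<pi> by (auto simp: apply_subst_assoc apply_subst_eq_iff)
  have l\<^sub>2\<tau>: "l\<^sub>2 \<cdot> \<tau> = l\<^sub>2 \<cdot> \<sigma>\<^sub>2" "r\<^sub>2 \<cdot> \<tau> = r\<^sub>2 \<cdot> \<sigma>\<^sub>2"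
    by (auto simp: \<tau>_def apply_subst_eq_iff)
  have unif: "l \<cdot> \<tau> = subterm_at l\<^sub>2 p \<cdot> \<tau>"
    using l\<tau> l\<^sub>2\<tau> \<sigma>(3) p by (metis subterm_at_apply_subst)
  show ?thesis
  proof (cases "p = [] \<and> is_variant (l, r) (l\<^sub>2, r\<^sub>2)")
    \<comment> \<open>A root overlap of a rule with a variant of itself yields no critical pair.
      Here both rules give the same result, because \<open>\<tau>\<close> unifies the left-hand
      sides and these contain all variables of the right-hand sides.\<close>
    case True
    then obtain \<rho> :: "'v \<Rightarrow> 'v" where \<rho>: "l\<^sub>2 = l \<cdot> (\<lambda>x. Var (\<rho> x))" "r\<^sub>2 = r \<cdot> (\<lambda>x. Var (\<rho> x))"
      unfolding is_variant_def map_term_eq_apply_subst by auto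
    have "\<forall>x \<in> vars_term l. \<tau> x = \<tau> (\<rho> x)"
      using unif True unfolding \<rho> by (simp add: apply_subst_assoc apply_subst_eq_iff)
    moreover have "vars_term r \<subseteq> vars_term l" using vars unfolding vlr by blast
    ultimately have "r \<cdot> \<tau> = r\<^sub>2 \<cdot> \<tau>"
      unfolding \<rho> by (auto simp: apply_subst_assoc apply_subst_eq_iff)
    then show ?thesis using True l\<tau> l\<^sub>2\<tau> by simp
  next
    case False
    have wf: "wf_term ar l" "wf_term ar (subterm_at l\<^sub>2 p)"
      using rules p unfolding lr
      by (auto simp: wf_term_apply_subst intro: wf_term_subterm_at dest: wf_rulesD)
    obtain \<theta> where \<theta>: "is_mgu ar \<theta> l (subterm_at l\<^sub>2 p)"
      using ex_is_mgu[OF wf unif] by blast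
    then obtain \<delta> where \<delta>: "is_subst ar \<delta>" "\<And>x. \<tau> x = \<theta> x \<cdot> \<delta>"
      using \<tau> unif unfolding is_mgu_def by blast
    have "\<tau> = (\<lambda>x. \<theta> x \<cdot> \<delta>)" using \<delta>(2) by (rule ext)
    then have \<tau>\<delta>: "t \<cdot> \<tau> = t \<cdot> \<theta> \<cdot> \<delta>" for t
      by (simp add: apply_subst_assoc)
    have "(vars_term l \<union> vars_term r) \<inter> ?V2 = {}"
      using \<pi>(2) unfolding vlr by blast
    then have "(replace_at l\<^sub>2 p r \<cdot> \<theta>, r\<^sub>2 \<cdot> \<theta>) \<in> CP_at ar R Q p"
      unfolding CP_at_def using rules variant is_variant_refl p \<theta> False by blast
    moreover have "replace_at (l\<^sub>2 \<cdot> \<sigma>\<^sub>2) p (r\<^sub>1 \<cdot> \<sigma>\<^sub>1) = replace_at l\<^sub>2 p r \<cdot> \<theta> \<cdot> \<delta>"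
      using replace_at_apply_subst[OF p(1), of r \<tau>] by (simp add: l\<tau> l\<^sub>2\<tau> flip: \<tau>\<delta>)
    moreover have "r\<^sub>2 \<cdot> \<sigma>\<^sub>2 = r\<^sub>2 \<cdot> \<theta> \<cdot> \<delta>"
      by (simp flip: l\<^sub>2\<tau> \<tau>\<delta>)
    ultimately show ?thesis using \<delta>(1) by blast
  qed
qed

text \<open>The redex either starts at a function symbol of \<open>t\<close> or lies inside some
  \<open>\<sigma> x\<close>. In the second case \<open>x\<close> may occur several times in
  \<open>t\<close>, so further steps contract the other copies before the result is again an
  instance of \<open>t\<close>.\<close>

lemma rstep_instance_cases:
  assumes "(t \<cdot> \<sigma>, v) \<in> rstep ar R" "wf_rules ar R"
  shows "(\<exists>p l r \<tau>. p \<in> poss t \<and> (\<forall>x. subterm_at t p \<noteq> Var x) \<and> (l, r) \<in> R \<and> is_subst ar \<tau> \<and>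
      subterm_at t p \<cdot> \<sigma> = l \<cdot> \<tau> \<and> v = replace_at (t \<cdot> \<sigma>) p (r \<cdot> \<tau>)) \<or>
    (\<exists>x w. x \<in> vars_term t \<and> (\<sigma> x, w) \<in> rstep ar R \<and> (v, t \<cdot> \<sigma>(x := w)) \<in> (rstep ar R)\<^sup>*)"
  using assms(1)
proof (induction t arbitrary: v)
  case (Var x)
  then show ?case by auto
next
  case (Fun f ts)
  from Fun(2) have wf: "wf_term ar (Fun f (map (\<lambda>t. t \<cdot> \<sigma>) ts))"
    by (auto dest: rstep_wf_left)
  from Fun(2) show ?case
  proof (cases rule: rstep_cases)
    case (root l r \<tau>)
    then show ?thesis
      by (intro disjI1 exI[of _ "[]"] exI[of _ l] exI[of _ r] exI[of _ \<tau>]) auto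
  next
    case (arg g ss i u)
    then have i: "i < length ts" "(ts ! i \<cdot> \<sigma>, u) \<in> rstep ar R"
      and v: "v = Fun f ((map (\<lambda>t. t \<cdot> \<sigma>) ts)[i := u])" by auto
    from Fun(1)[OF nth_mem[OF i(1)] i(2)] show ?thesis
    proof (elim disjE exE conjE)
      fix p l r \<tau>
      assume "p \<in> poss (ts ! i)" "\<forall>x. subterm_at (ts ! i) p \<noteq> Var x" "(l, r) \<in> R"
        "is_subst ar \<tau>" "subterm_at (ts ! i) p \<cdot> \<sigma> = l \<cdot> \<tau>"
        "u = replace_at (ts ! i \<cdot> \<sigma>) p (r \<cdot> \<tau>)"
      with i v show ?thesis
        by (intro disjI1 exI[of _ "Suc i # p"] exI[of _ l] exI[of _ r] exI[of _ \<tau>]) auto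
    next
      fix x w
      assume x: "x \<in> vars_term (ts ! i)" "(\<sigma> x, w) \<in> rstep ar R"
        and u: "(u, ts ! i \<cdot> \<sigma>(x := w)) \<in> (rstep ar R)\<^sup>*"
      have wfu: "wf_term ar u" using i(2) assms(2) by (rule rstep_wf_right)
      have "(v, Fun f ts \<cdot> \<sigma>(x := w)) \<in> (rstep ar R)\<^sup>*"
        unfolding v apply_subst.simps
      proof (rule rsteps_args)
        fix j assume j: "j < ar f"
        show "((map (\<lambda>t. t \<cdot> \<sigma>) ts)[i := u] ! j, map (\<lambda>t. t \<cdot> \<sigma>(x := w)) ts ! j) \<in> (rstep ar R)\<^sup>*"
        proof (cases "j = i")
          case True
          with u i j wf show ?thesis by simp
        next
          \<comment> \<open>The other arguments may contain \<open>x\<close> as well, and their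
            copies are rewritten now; argument \<open>i\<close> was handled by the induction
            hypothesis.\<close>
          case False
          have "(ts ! j \<cdot> \<sigma>, ts ! j \<cdot> \<sigma>(x := w)) \<in> (rstep ar R)\<^sup>*"
            using x(2) assms(2) wf j by (intro rsteps_subst) auto
          with False j wf show ?thesis by simp
        qed
      qed (use assms wf wf_term_Fun_update[OF wf wfu] in auto)
      moreover have "x \<in> vars_term (Fun f ts)" using x(1) i(1) by auto
      ultimately show ?thesis using x(2) by blast
    qed
  qed
qed

text \<open>The case analysis shared by \<open>S\<close>-peaks against root steps of
  \<open>S\<close> and of \<open>E\<close>. The outcome \<open>same\<close> covers a rule
  overlapping with its own variant at the root.\<close>

lemma rstep_left_instance_cases:
  fixes R Q :: "('f, 'v) rule set"
  assumes "infinite (UNIV :: 'v set)" "wf_rules ar R" "wf_rules ar Q"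
    and "\<forall>(l, r) \<in> R. vars_term r \<subseteq> vars_term l"
    and "(l, r) \<in> Q" "is_subst ar \<sigma>" "(l \<cdot> \<sigma>, v) \<in> rstep ar R"
  obtains (same) "v = r \<cdot> \<sigma>"
  | (critical) a b \<delta> where "(a, b) \<in> CP ar R Q" "is_subst ar \<delta>" "v = a \<cdot> \<delta>" "r \<cdot> \<sigma> = b \<cdot> \<delta>"
  | (variable) x w where "x \<in> vars_term l" "(\<sigma> x, w) \<in> rstep ar R"
      "(v, l \<cdot> \<sigma>(x := w)) \<in> (rstep ar R)\<^sup>*"
proof -
  from rstep_instance_cases[OF assms(7,2)] show ?thesis
  proof (elim disjE exE conjE)
    fix p l' r' \<tau>
    assume *: "p \<in> poss l" "\<forall>x. subterm_at l p \<noteq> Var x" "(l', r') \<in> R" "is_subst ar \<tau>"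
      "subterm_at l p \<cdot> \<sigma> = l' \<cdot> \<tau>" "v = replace_at (l \<cdot> \<sigma>) p (r' \<cdot> \<tau>)"
    have "vars_term r' \<subseteq> vars_term l'" using assms(4) *(3) by blast
    from overlap_instance_of_CP[OF assms(1) *(3) assms(5,2,3) this *(1,2,4) assms(6) *(5)]
    show ?thesis
    proof (elim disjE exE conjE)
      assume "p = []" "r' \<cdot> \<tau> = r \<cdot> \<sigma>"
      with *(6) same show ?thesis by simp
    next
      fix a b \<delta>
      assume "(a, b) \<in> CP_at ar R Q p" "is_subst ar \<delta>"
        "replace_at (l \<cdot> \<sigma>) p (r' \<cdot> \<tau>) = a \<cdot> \<delta>" "r \<cdot> \<sigma> = b \<cdot> \<delta>"
      with *(6) show ?thesis by (intro critical[of a b \<delta>]) (auto simp: CP_def)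
    qed
  qed (rule variable)
qed

text \<open>Arguments of a linear term share no variables, so the substitutions found for them can
  be glued together; \<open>SOME i\<close> picks the only possible argument. It is separate from
  \<open>par_linear_instance\<close> because an \<open>S\<close>-redex is treated argument by
  argument, with overlaps excluded only below its root.\<close>

lemma par_linear_instance_args:
  assumes "\<And>i. i < length ts \<Longrightarrow>
      \<exists>\<tau>. us ! i = ts ! i \<cdot> \<tau> \<and> (\<forall>x. (\<sigma> x, \<tau> x) \<in> par ar R) \<and> (\<forall>x. x \<notin> vars_term (ts ! i) \<longrightarrow> \<tau> x = \<sigma> x)"
    and "linear_term (Fun f ts)" "length us = length ts" "\<forall>x. wf_term ar (\<sigma> x)"
  shows "\<exists>\<tau>. us = map (\<lambda>t. t \<cdot> \<tau>) ts \<and> (\<forall>x. (\<sigma> x, \<tau> x) \<in> par ar R) \<and>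
    (\<forall>x. x \<notin> vars_term (Fun f ts) \<longrightarrow> \<tau> x = \<sigma> x)"
proof -
  obtain T where T: "\<And>i. i < length ts \<Longrightarrow> us ! i = ts ! i \<cdot> T i"
    "\<And>i x. i < length ts \<Longrightarrow> (\<sigma> x, T i x) \<in> par ar R"
    using assms(1) by metis
  define \<tau> where "\<tau> x = (if x \<in> vars_term (Fun f ts)
    then T (SOME i. i < length ts \<and> x \<in> vars_term (ts ! i)) x else \<sigma> x)" for x
  have \<tau>: "\<tau> x = T i x" if i: "i < length ts" "x \<in> vars_term (ts ! i)" for i x
  proof -
    have unique: "j = i" if "j < length ts \<and> x \<in> vars_term (ts ! j)" for j
      using that i linear_term_Fun(2)[OF assms(2)] by blast
    have "(SOME i. i < length ts \<and> x \<in> vars_term (ts ! i)) = i"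
    proof (rule some_equality)
      show "i < length ts \<and> x \<in> vars_term (ts ! i)" using i by simp
    qed (rule unique)
    moreover have "x \<in> vars_term (Fun f ts)"
      using i by auto
    ultimately show ?thesis
      by (simp only: \<tau>_def if_True)
  qed
  have "us = map (\<lambda>t. t \<cdot> \<tau>) ts"
    using assms(3) by (intro nth_equalityI) (auto simp: T(1) apply_subst_eq_iff \<tau>)
  moreover have "(\<sigma> x, \<tau> x) \<in> par ar R" for x
  proof (cases "x \<in> vars_term (Fun f ts)")
    case True
    then obtain i where "i < length ts" "x \<in> vars_term (ts ! i)"
      by (auto simp: in_set_conv_nth)
    then show ?thesis using T(2) \<tau> by simp
  next
    case False
    then show ?thesis using assms(4) by (auto simp: \<tau>_def intro: par_refl)
  qed
  ultimately show ?thesis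
    by (intro exI[of _ \<tau>]) (auto simp: \<tau>_def)
qed

text \<open>No redex starts at a function symbol of \<open>t\<close>, so all contracted redexes lie
  inside the substitution. By linearity each variable occurs at most once, so its one contractum
  defines \<open>\<tau>\<close>.\<close>

lemma par_linear_instance:
  assumes "(t \<cdot> \<sigma>, v) \<in> par ar R" "linear_term t" "\<forall>x. wf_term ar (\<sigma> x)"
    and "\<And>p l r \<tau>. p \<in> poss t \<Longrightarrow> \<forall>x. subterm_at t p \<noteq> Var x \<Longrightarrow> (l, r) \<in> R \<Longrightarrow>
      is_subst ar \<tau> \<Longrightarrow> subterm_at t p \<cdot> \<sigma> \<noteq> l \<cdot> \<tau>"
  shows "\<exists>\<tau>. v = t \<cdot> \<tau> \<and> (\<forall>x. (\<sigma> x, \<tau> x) \<in> par ar R) \<and> (\<forall>x. x \<notin> vars_term t \<longrightarrow> \<tau> x = \<sigma> x)"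
  using assms
proof (induction t arbitrary: v)
  case (Var x)
  then show ?case by (intro exI[of _ "\<sigma>(x := v)"]) (auto intro: par_refl)
next
  case (Fun f ts)
  from Fun(2) show ?case
  proof (cases rule: par.cases)
    case par_refl
    with Fun(4) show ?thesis by (auto intro: par.par_refl)
  next
    case (par_root l r \<tau>)
    then show ?thesis using Fun(5)[of "[]" l r \<tau>] by auto
  next
    case (par_args ss g us)
    have "\<exists>\<tau>. us = map (\<lambda>t. t \<cdot> \<tau>) ts \<and> (\<forall>x. (\<sigma> x, \<tau> x) \<in> par ar R) \<and>
      (\<forall>x. x \<notin> vars_term (Fun f ts) \<longrightarrow> \<tau> x = \<sigma> x)"
    proof (rule par_linear_instance_args[OF _ Fun(3) _ Fun(4)])
      fix i assume i: "i < length ts"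
      show "\<exists>\<tau>. us ! i = ts ! i \<cdot> \<tau> \<and> (\<forall>x. (\<sigma> x, \<tau> x) \<in> par ar R) \<and>
        (\<forall>x. x \<notin> vars_term (ts ! i) \<longrightarrow> \<tau> x = \<sigma> x)"
      proof (rule Fun(1))
        show "ts ! i \<in> set ts" "(ts ! i \<cdot> \<sigma>, us ! i) \<in> par ar R" "linear_term (ts ! i)"
          "\<forall>x. wf_term ar (\<sigma> x)"
          using i par_args Fun(4) linear_term_Fun(1)[OF Fun(3) i] by auto
        show "subterm_at (ts ! i) p \<cdot> \<sigma> \<noteq> l \<cdot> \<tau>"
          if "p \<in> poss (ts ! i)" "\<forall>x. subterm_at (ts ! i) p \<noteq> Var x" "(l, r) \<in> R" "is_subst ar \<tau>"
          for p l r \<tau>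
          using Fun(5)[of "Suc i # p" l r \<tau>] that i by simp
      qed
    qed (use par_args in auto)
    with par_args show ?thesis by auto
  qed
qed

section \<open>Peaks\<close>

lemma wf_converse_terminating_relative:
  "terminating_relative ar S Q \<longleftrightarrow> wf ((rstep ar S O (rstep ar Q)\<^sup>*)\<inverse>)"
  by (simp add: terminating_relative_def wf_iff_no_infinite_down_chain)

text \<open>\<open>E\<close> stands for \<open>P \<union> P\<inverse>\<close> and \<open>Q\<close>
  for \<open>P'\<close>. Symmetry and the variable condition together say that both sides of a rule
  of \<open>E\<close> have the same variables. Infinitely many variables allow rules to be renamed
  apart.\<close>

locale reduction_preserving =
  fixes ar :: "'f \<Rightarrow> nat" and S E Q :: "('f, 'v) rule set"
  assumes inf: "infinite (UNIV :: 'v set)"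
    and S: "is_trs ar S" "left_linear S"
    and E: "wf_rules ar E" "sym E" "\<forall>(l, r) \<in> E. vars_term r \<subseteq> vars_term l"
    and Q: "Q \<subseteq> E"
    and terminating: "terminating_relative ar S Q"
    and CP_SS: "CP ar S S \<subseteq>
      (rstep ar (S \<union> Q))\<^sup>* O (par_rstep ar E)\<inverse> O ((rstep ar (S \<union> Q))\<^sup>*)\<inverse>"
    and CP_in_ES: "CP_in ar E S = {}"
    and CP_SE: "CP ar S E \<subseteq> ((rstep ar (S \<union> Q))\<^sup>* O par_rstep ar E) \<union>
      ((rstep ar (S \<union> Q))\<^sup>* O par_rstep ar E O ((rstep ar (S \<union> Q))\<^sup>*)\<inverse> O (rstep ar S)\<inverse>)"
begin

abbreviation Ks :: "('f, 'v) term rel" where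
  "Ks \<equiv> (rstep ar (S \<union> Q))\<^sup>*"

text \<open>\<open>join_SS\<close> and \<open>join_SE\<close> are the shapes required by
  \<open>peak_HH\<close> and \<open>peak_HV\<close>; they contain the critical pairs and are closed
  under substitutions.\<close>

definition join_SS :: "('f, 'v) term rel" where
  "join_SS = Ks O par ar E O Ks\<inverse>"

definition join_SE :: "('f, 'v) term rel" where
  "join_SE = (Ks O par ar E) \<union> (Ks O par ar E O Ks\<inverse> O (rstep ar S)\<inverse>)"

lemma wfS: "wf_rules ar S"
  using S(1) by (rule is_trs_wf_rules)

lemma wfK: "wf_rules ar (S \<union> Q)"
  using wfS E(1) Q by (auto simp: wf_rules_def)

lemma vars_S: "\<forall>(l, r) \<in> S. vars_term r \<subseteq> vars_term l"
  using S(1) by (auto simp: is_trs_def)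

lemma S_Ks: "(s, t) \<in> rstep ar S \<Longrightarrow> (s, t) \<in> Ks"
  by (auto simp: rstep_Un)

lemma Ss_Ks: "(s, t) \<in> (rstep ar S)\<^sup>* \<Longrightarrow> (s, t) \<in> Ks"
  using rtrancl_mono[of "rstep ar S" "rstep ar (S \<union> Q)"] by (auto simp: rstep_Un)

lemma sym_E: "(s, t) \<in> par ar E \<Longrightarrow> (t, s) \<in> par ar E"
  using sym_par[OF E(1,2)] by (rule symD)

lemma par_rstep_E: "(s, t) \<in> par_rstep ar E \<Longrightarrow> (s, t) \<in> par ar E"
  using par_rstep_subset_par by blast

lemma join_SS_sym: "(s, t) \<in> join_SS \<Longrightarrow> (t, s) \<in> join_SS"
  unfolding join_SS_def using sym_E by blast

text \<open>A loop would give a constant infinite chain. In a variable overlap with \<open>E\<close>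
  this shows that \<open>w\<close> differs from \<open>\<sigma> x\<close>.\<close>

lemma S_irrefl: "(s, s) \<notin> rstep ar S"
proof
  assume "(s, s) \<in> rstep ar S"
  then have "\<exists>t :: nat \<Rightarrow> ('f, 'v) term. \<forall>i. (t i, t (Suc i)) \<in> rstep ar S O (rstep ar Q)\<^sup>*"
    by (intro exI[of _ "\<lambda>_. s"]) blast
  then show False
    using terminating by (simp add: terminating_relative_def)
qed

section \<open>Closure of the joining relations under substitutions and contexts\<close>

lemma join_SS_apply_subst: "(s, t) \<in> join_SS \<Longrightarrow> is_subst ar \<delta> \<Longrightarrow> (s \<cdot> \<delta>, t \<cdot> \<delta>) \<in> join_SS"
  unfolding join_SS_def
  by (elim relcompE converseE)
    (blast intro: relcompI converseI rsteps_apply_subst par_apply_subst)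

lemma join_SE_apply_subst: "(s, t) \<in> join_SE \<Longrightarrow> is_subst ar \<delta> \<Longrightarrow> (s \<cdot> \<delta>, t \<cdot> \<delta>) \<in> join_SE"
  unfolding join_SE_def
  by (elim UnE relcompE converseE)
    (blast intro: relcompI converseI rsteps_apply_subst par_apply_subst rstep_apply_subst)+

lemma CP_SS_join: "(a, b) \<in> CP ar S S \<Longrightarrow> (a, b) \<in> join_SS"
  using CP_SS par_rstep_E sym_E unfolding join_SS_def by blast

lemma CP_SE_join: "(a, b) \<in> CP ar S E \<Longrightarrow> (a, b) \<in> join_SE"
  using CP_SE par_rstep_E unfolding join_SE_def by blast

lemma Ks_arg:
  assumes "(s, t) \<in> Ks" "i < length ss" "wf_term ar (Fun f ss)" "wf_term ar s"
  shows "(Fun f (ss[i := s]), Fun f (ss[i := t])) \<in> Ks"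
  using assms(1) wfK assms(2) wf_term_Fun_update[OF assms(3,4)] by (rule rsteps_arg)

lemma par_update:
  assumes "\<And>j. j < ar f \<Longrightarrow> (ss ! j, ts ! j) \<in> par ar E" "(a, b) \<in> par ar E"
    and "length ss = ar f" "length ts = ar f"
  shows "(Fun f (ss[i := a]), Fun f (ts[i := b])) \<in> par ar E"
proof (rule par_args)
  show "(ss[i := a] ! j, ts[i := b] ! j) \<in> par ar E" if "j < ar f" for j
    using assms that by (cases "i = j") auto
qed (use assms in auto)

lemma join_SS_arg:
  assumes "(a, b) \<in> join_SS" "i < length ss" "wf_term ar (Fun f ss)" "wf_term ar a" "wf_term ar b"
  shows "(Fun f (ss[i := a]), Fun f (ss[i := b])) \<in> join_SS"
proof -
  obtain c d where cd: "(a, c) \<in> Ks" "(c, d) \<in> par ar E" "(b, d) \<in> Ks"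
    using assms(1) unfolding join_SS_def by blast
  have "(Fun f (ss[i := c]), Fun f (ss[i := d])) \<in> par ar E"
    using cd(2) assms(3) by (intro par_update) (auto intro: par_refl)
  with cd assms show ?thesis
    unfolding join_SS_def by (blast intro: Ks_arg)
qed

text \<open>The parallel steps of the other arguments are merged with the parallel step in argument
  \<open>i\<close>, and the \<open>S \<union> Q\<close>-steps act on argument \<open>i\<close>
  alone. Hence a single parallel step suffices in either alternative.\<close>

lemma join_SE_args:
  assumes ss_ts: "\<And>j. j < ar f \<Longrightarrow> (ss ! j, ts ! j) \<in> par ar E"
    and len: "length ss = ar f" "length ts = ar f"
    and a: "(a, ts ! i) \<in> join_SE" "i < ar f" "wf_term ar a"
  shows "(Fun f (ss[i := a]), Fun f ts) \<in> join_SE"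
proof -
  have wf: "wf_term ar (Fun f ss)" "wf_term ar (Fun f ts)"
    using ss_ts len par_wf_left par_wf_right E(1) by (fastforce simp: in_set_conv_nth)+
  from a(1) show ?thesis
    unfolding join_SE_def
  proof (elim UnE)
    assume "(a, ts ! i) \<in> Ks O par ar E"
    then obtain c where c: "(a, c) \<in> Ks" "(c, ts ! i) \<in> par ar E" by blast
    have "(Fun f (ss[i := c]), Fun f (ts[i := ts ! i])) \<in> par ar E"
      using ss_ts c(2) len by (rule par_update)
    with Ks_arg[OF c(1) _ wf(1) a(3), of i] a(2) len
    have "(Fun f (ss[i := a]), Fun f ts) \<in> Ks O par ar E" by auto
    then show "(Fun f (ss[i := a]), Fun f ts) \<in> Ks O par ar E \<union> Ks O par ar E O Ks\<inverse> O (rstep ar S)\<inverse>"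
      by blast
  next
    assume "(a, ts ! i) \<in> Ks O par ar E O Ks\<inverse> O (rstep ar S)\<inverse>"
    then obtain c d e where c: "(a, c) \<in> Ks" "(c, d) \<in> par ar E" "(e, d) \<in> Ks" "(ts ! i, e) \<in> rstep ar S"
      by blast
    have "(Fun f (ss[i := c]), Fun f (ts[i := d])) \<in> par ar E"
      using ss_ts c(2) len by (rule par_update)
    moreover have "(Fun f (ss[i := a]), Fun f (ss[i := c])) \<in> Ks"
      using Ks_arg[OF c(1) _ wf(1) a(3), of i] a(2) len by simp
    moreover have "(Fun f ts, Fun f (ts[i := e])) \<in> rstep ar S"
      using rstep_arg[of ts i, OF c(4) _ wf(2)] a(2) len by simp
    moreover have "(Fun f (ts[i := e]), Fun f (ts[i := d])) \<in> Ks"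
      using Ks_arg[OF c(3) _ wf(2) rstep_wf_right[OF c(4) wfS], of i] a(2) len by simp
    ultimately show "(Fun f (ss[i := a]), Fun f ts) \<in> Ks O par ar E \<union> Ks O par ar E O Ks\<inverse> O (rstep ar S)\<inverse>"
      by blast
  qed
qed

text \<open>Critical overlaps are instances of critical pairs. In a variable overlap, contracting
  the remaining copies of \<open>x\<close> makes the rule applicable again, and both sides meet in
  the instance of \<open>r\<close> under the changed substitution.\<close>

lemma peak_SS_root:
  assumes "(l, r) \<in> S" "is_subst ar \<sigma>" "(l \<cdot> \<sigma>, v) \<in> rstep ar S"
  shows "(v, r \<cdot> \<sigma>) \<in> join_SS"
  using inf wfS wfS vars_S assms
proof (cases rule: rstep_left_instance_cases)
  case same
  have "wf_term ar v" using assms(3) wfS by (rule rstep_wf_right)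
  with same show ?thesis unfolding join_SS_def by (blast intro: par_refl)
next
  case (critical a b \<delta>)
  then show ?thesis by (simp add: CP_SS_join join_SS_apply_subst)
next
  case (variable x w)
  let ?\<sigma> = "\<sigma>(x := w)"
  have wfw: "wf_term ar w"
    using variable(2) wfS by (rule rstep_wf_right)
  with assms(2) have \<sigma>': "is_subst ar ?\<sigma>"
    by (rule is_subst_upd)
  have wf: "wf_term ar (l \<cdot> ?\<sigma>)" "wf_term ar (r \<cdot> \<sigma>)" "wf_term ar (r \<cdot> ?\<sigma>)"
    using assms wfw wf_rulesD[OF wfS assms(1)] by (auto simp: wf_term_apply_subst is_substD)
  have "(l \<cdot> ?\<sigma>, r \<cdot> ?\<sigma>) \<in> rstep ar S"
    using assms(1) \<sigma>' wf(1) by (rule rstep_root)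
  with variable(3) have "(v, r \<cdot> ?\<sigma>) \<in> Ks"
    by (intro Ss_Ks) (rule rtrancl_into_rtrancl)
  moreover have "(r \<cdot> \<sigma>, r \<cdot> ?\<sigma>) \<in> Ks"
    using variable(2) wf wfS by (intro Ss_Ks rsteps_subst) auto
  ultimately show ?thesis
    unfolding join_SS_def using wf(3) by (blast intro: par_refl)
qed

text \<open>If neither step is at the root, steps in different arguments commute and steps in the
  same argument are joined by induction on the size.\<close>

lemma peak_SS:
  assumes "(s, u) \<in> rstep ar S" "(s, v) \<in> rstep ar S"
  shows "(u, v) \<in> join_SS"
  using assms
proof (induction s arbitrary: u v rule: measure_induct_rule[of size])
  case (less s)
  have wf: "wf_term ar s" "wf_term ar u" "wf_term ar v"
    using less(2,3) rstep_wf_left rstep_wf_right wfS by blast+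
  from less(2) show ?case
  proof (cases rule: rstep_cases)
    case (root l r \<sigma>)
    with less(3) show ?thesis using peak_SS_root by (auto intro: join_SS_sym)
  next
    case s: (arg f ss i a)
    from less(3) show ?thesis
    proof (cases rule: rstep_cases)
      case (root l r \<sigma>)
      with less(2) show ?thesis using peak_SS_root by auto
    next
      case (arg g ss' j b)
      have wf': "wf_term ar a" "wf_term ar b"
        using rstep_wf_right[OF s(3) wfS] rstep_wf_right[OF arg(3) wfS] by auto
      show ?thesis
      proof (cases "i = j")
        case True
        have "size (ss ! i) < size s"
          using size_nth_term_less[OF s(2)] s(1) by simp
        then have "(a, b) \<in> join_SS"
          using s arg True by (intro less(1)) auto
        with s arg True wf' show ?thesis
          using join_SS_arg[of a b i ss f] wf(1) by simp
      next
        case False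
        have "(Fun f (ss[i := a]), Fun f (ss[i := a, j := b])) \<in> rstep ar S"
          using s arg False wf by (intro rstep_arg) auto
        moreover have "(Fun f (ss[j := b]), Fun f (ss[j := b, i := a])) \<in> rstep ar S"
          using s arg False wf by (intro rstep_arg) auto
        moreover have "ss[j := b, i := a] = ss[i := a, j := b]"
          using False by (rule list_update_swap[symmetric])
        moreover have "wf_term ar (Fun f (ss[i := a, j := b]))"
          using calculation(1) wfS by (rule rstep_wf_right)
        ultimately show ?thesis
          using s arg unfolding join_SS_def by (auto dest!: S_Ks intro!: relcompI intro: par_refl)
      qed
    qed
  qed
qed

text \<open>In a variable overlap, \<open>S\<close>-steps contract the remaining copies in
  \<open>l \<cdot> \<sigma>\<close> and all copies in \<open>r \<cdot> \<sigma>\<close>, after which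
  the \<open>E\<close>-rule connects the two terms. The second alternative of \<open>join_SE\<close>
  asks for at least one \<open>S\<close>-step out of \<open>r \<cdot> \<sigma>\<close>.\<close>

lemma peak_SE_root:
  assumes "(l, r) \<in> E" "is_subst ar \<sigma>" "(l \<cdot> \<sigma>, u) \<in> rstep ar S"
  shows "(u, r \<cdot> \<sigma>) \<in> join_SE"
  using inf wfS E(1) vars_S assms
proof (cases rule: rstep_left_instance_cases)
  case same
  have "wf_term ar u" using assms(3) wfS by (rule rstep_wf_right)
  with same show ?thesis unfolding join_SE_def by (blast intro: par_refl)
next
  case (critical a b \<delta>)
  then show ?thesis by (simp add: CP_SE_join join_SE_apply_subst)
next
  case (variable x w)
  let ?\<sigma> = "\<sigma>(x := w)"
  have wfw: "wf_term ar w"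
    using variable(2) wfS by (rule rstep_wf_right)
  with assms(2) have \<sigma>': "is_subst ar ?\<sigma>"
    by (rule is_subst_upd)
  have wf: "wf_term ar (l \<cdot> ?\<sigma>)" "wf_term ar (r \<cdot> \<sigma>)" "wf_term ar (r \<cdot> ?\<sigma>)"
    using assms wfw wf_rulesD[OF E(1) assms(1)] by (auto simp: wf_term_apply_subst is_substD)
  have "(l \<cdot> ?\<sigma>, r \<cdot> ?\<sigma>) \<in> par ar E"
    using assms(1) \<sigma>' wf(1) by (rule par_root)
  moreover have "(u, l \<cdot> ?\<sigma>) \<in> Ks"
    using variable(3) by (rule Ss_Ks)
  \<comment> \<open>The converse rule \<open>(r, l)\<close> is in \<open>E\<close> too, so
    \<open>r\<close> contains every variable of \<open>l\<close>; this makes the reduction from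
    \<open>r \<cdot> \<sigma>\<close> nonempty.\<close>
  moreover have "x \<in> vars_term r"
    using variable(1) E(2,3) assms(1) by (blast dest: symD)
  then have "r \<cdot> \<sigma> \<noteq> r \<cdot> ?\<sigma>"
    using variable(2) S_irrefl by (auto simp: apply_subst_eq_iff)
  moreover have "(r \<cdot> \<sigma>, r \<cdot> ?\<sigma>) \<in> (rstep ar S)\<^sup>*"
    using variable(2) wf wfS by (intro rsteps_subst) auto
  ultimately obtain z where "(r \<cdot> \<sigma>, z) \<in> rstep ar S" "(z, r \<cdot> ?\<sigma>) \<in> Ks"
    by (meson converse_rtranclE Ss_Ks)
  with \<open>(l \<cdot> ?\<sigma>, r \<cdot> ?\<sigma>) \<in> par ar E\<close> \<open>(u, l \<cdot> ?\<sigma>) \<in> Ks\<close> show ?thesis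
    unfolding join_SE_def by blast
qed

text \<open>The parallel step below the root only changes the substitution from
  \<open>\<sigma>\<close> to some \<open>\<tau>\<close>, so the \<open>S\<close>-rule still applies
  afterwards. Its result \<open>r \<cdot> \<tau>\<close> is reached from
  \<open>r \<cdot> \<sigma>\<close> by one parallel step, however often \<open>r\<close> repeats a
  variable.\<close>

lemma peak_SE_left_linear:
  assumes lr: "(l, r) \<in> S" and \<sigma>: "is_subst ar \<sigma>"
    and args: "l \<cdot> \<sigma> = Fun f ss" "length ss = ar f" "length ts = ar f"
      "\<And>i. i < ar f \<Longrightarrow> (ss ! i, ts ! i) \<in> par ar E"
  shows "(r \<cdot> \<sigma>, Fun f ts) \<in> join_SE"
proof -
  have "\<forall>x. l \<noteq> Var x" using S(1) lr by (auto simp: is_trs_def)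
  then obtain ls where l: "l = Fun f ls" "ss = map (\<lambda>t. t \<cdot> \<sigma>) ls"
    using args(1) by (cases l) auto
  have linear: "linear_term (Fun f ls)" using S(2) lr l by (auto simp: left_linear_def)
  \<comment> \<open>\<open>CP_in\<close> speaks of overlaps strictly below the root, hence
    \<open>p \<noteq> []\<close>. For such \<open>p\<close> any overlap produces a member of
    \<open>CP_at ar E S p\<close>.\<close>
  have no_overlap: "subterm_at l p \<cdot> \<sigma> \<noteq> l' \<cdot> \<tau>"
    if "p \<in> poss l" "\<forall>x. subterm_at l p \<noteq> Var x" "p \<noteq> []" "(l', r') \<in> E" "is_subst ar \<tau>"
    for p l' r' \<tau>
  proof
    assume eq: "subterm_at l p \<cdot> \<sigma> = l' \<cdot> \<tau>"
    have "vars_term r' \<subseteq> vars_term l'" using E(3) that(4) by blast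
    from overlap_instance_of_CP[OF inf that(4) lr E(1) wfS this that(1,2,5) \<sigma> eq]
    have "CP_at ar E S p \<noteq> {}" using that(3) by blast
    then show False using CP_in_ES that(3) unfolding CP_in_def by blast
  qed
  have "\<exists>\<tau>. ts = map (\<lambda>t. t \<cdot> \<tau>) ls \<and> (\<forall>x. (\<sigma> x, \<tau> x) \<in> par ar E) \<and>
    (\<forall>x. x \<notin> vars_term (Fun f ls) \<longrightarrow> \<tau> x = \<sigma> x)"
  proof (rule par_linear_instance_args[OF _ linear])
    fix i assume i: "i < length ls"
    show "\<exists>\<tau>. ts ! i = ls ! i \<cdot> \<tau> \<and> (\<forall>x. (\<sigma> x, \<tau> x) \<in> par ar E) \<and>
      (\<forall>x. x \<notin> vars_term (ls ! i) \<longrightarrow> \<tau> x = \<sigma> x)"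
    proof (rule par_linear_instance)
      show "(ls ! i \<cdot> \<sigma>, ts ! i) \<in> par ar E" "linear_term (ls ! i)" "\<forall>x. wf_term ar (\<sigma> x)"
        using i args l \<sigma> linear_term_Fun(1)[OF linear i] by (auto simp: is_substD)
      show "subterm_at (ls ! i) p \<cdot> \<sigma> \<noteq> l' \<cdot> \<tau>"
        if "p \<in> poss (ls ! i)" "\<forall>x. subterm_at (ls ! i) p \<noteq> Var x" "(l', r') \<in> E" "is_subst ar \<tau>"
        for p l' r' \<tau>
        using no_overlap[of "Suc i # p" l' r' \<tau>] that i l by simp
    qed
  qed (use args l \<sigma> in \<open>auto simp: is_substD\<close>)
  then obtain \<tau> where \<tau>: "ts = map (\<lambda>t. t \<cdot> \<tau>) ls" "\<And>x. (\<sigma> x, \<tau> x) \<in> par ar E"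
    "\<And>x. x \<notin> vars_term (Fun f ls) \<Longrightarrow> \<tau> x = \<sigma> x"
    by blast
  \<comment> \<open>Agreement with \<open>\<sigma>\<close> outside the finitely many variables of
    the left-hand side keeps the domain finite.\<close>
  have \<tau>': "is_subst ar \<tau>"
    by (rule is_subst_finite_change[OF \<sigma>, of "vars_term (Fun f ls)"])
      (use \<tau>(3) par_wf_right[OF \<tau>(2) E(1)] in auto)
  have "(l \<cdot> \<tau>, r \<cdot> \<tau>) \<in> rstep ar S"
    using lr \<tau>' wf_rulesD[OF wfS lr] by (intro rstep_root) (auto simp: wf_term_apply_subst is_substD)
  moreover have "l \<cdot> \<tau> = Fun f ts" using l \<tau>(1) by simp
  moreover have "(r \<cdot> \<sigma>, r \<cdot> \<tau>) \<in> par ar E"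
    using \<tau>(2) wf_rulesD[OF wfS lr] by (intro par_subst) auto
  ultimately show ?thesis unfolding join_SE_def by auto
qed

text \<open>A root step of \<open>E\<close> and a root step of \<open>S\<close> above a parallel
  step in the arguments are the two lemmas before. Otherwise the argument containing the
  \<open>S\<close>-step is treated by induction on the size, and the remaining arguments follow by
  \<open>join_SE_args\<close>.\<close>

lemma peak_SE:
  assumes "(s, u) \<in> rstep ar S" "(s, v) \<in> par ar E"
  shows "(u, v) \<in> join_SE"
  using assms
proof (induction s arbitrary: u v rule: measure_induct_rule[of size])
  case (less s)
  have wf: "wf_term ar s" "wf_term ar u"
    using less(2) rstep_wf_left rstep_wf_right wfS by blast+
  from less(3) show ?case
  proof (cases rule: par.cases)
    \<comment> \<open>Here \<open>v\<close> is \<open>s\<close>, and the given \<open>S\<close>-step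
      from \<open>s\<close> to \<open>u\<close> serves as the closing step of the second
      alternative.\<close>
    case par_refl
    with less(2) wf show ?thesis
      unfolding join_SE_def by (blast intro: par.par_refl)
  next
    case (par_root l r \<sigma>)
    with less(2) show ?thesis by (auto intro: peak_SE_root)
  next
    case (par_args ss f ts)
    from less(2) show ?thesis
    proof (cases rule: rstep_cases)
      case (root l r \<sigma>)
      with par_args show ?thesis using peak_SE_left_linear[of l r \<sigma> f ss ts] by simp
    next
      case (arg g ss' i a)
      with par_args have i: "i < ar f" "(ss ! i, a) \<in> rstep ar S" "u = Fun f (ss[i := a])" by auto
      moreover have "size (ss ! i) < size s"
        using par_args i by (simp add: size_nth_term_less)
      ultimately have "(a, ts ! i) \<in> join_SE"
        using par_args by (intro less(1)) auto
      then show ?thesis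
        unfolding i(3) par_args(2)
        using par_args i(1,2) rstep_wf_right[OF i(2) wfS] by (intro join_SE_args) auto
    qed
  qed
qed

sublocale church_rosser_modulo "rstep ar S" "par ar E" "rstep ar Q"
proof
  show "sym (par ar E)" using E(1,2) by (rule sym_par)
  show "rstep ar Q \<subseteq> par ar E" using rstep_mono[OF Q] rstep_subset_par by blast
  show "wf ((rstep ar S O (rstep ar Q)\<^sup>*)\<inverse>)"
    using terminating by (simp add: wf_converse_terminating_relative)
  show "(rstep ar S)\<inverse> O rstep ar S \<subseteq>
    (rstep ar S \<union> rstep ar Q)\<^sup>* O par ar E O ((rstep ar S \<union> rstep ar Q)\<^sup>*)\<inverse>"
    using peak_SS unfolding join_SS_def rstep_Un by blast
  show "(rstep ar S)\<inverse> O par ar E \<subseteq> (rstep ar S \<union> rstep ar Q)\<^sup>* O par ar E \<union>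
    (rstep ar S \<union> rstep ar Q)\<^sup>* O par ar E O ((rstep ar S \<union> rstep ar Q)\<^sup>*)\<inverse> O (rstep ar S)\<inverse>"
    using peak_SE unfolding join_SE_def rstep_Un by blast
qed

end

section \<open>Reversible systems\<close>

text \<open>By reversibility \<open>r\<close> rewrites back to \<open>l\<close>, and rewriting
  creates no variables.\<close>

lemma reversible_vars:
  assumes "is_trs ar P" "reversible ar P" "(l, r) \<in> P"
  shows "vars_term l = vars_term r"
proof -
  have vars: "\<forall>(l, r) \<in> P. vars_term r \<subseteq> vars_term l"
    using assms(1) by (auto simp: is_trs_def)
  have "(l \<cdot> Var, r \<cdot> Var) \<in> rstep ar P"
    using assms(3) wf_rulesD[OF is_trs_wf_rules[OF assms(1)] assms(3)] by (intro rstep_root) auto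
  then have "(r, l) \<in> (rstep ar P)\<^sup>*"
    using assms(2) by (simp add: reversible_def)
  then have "vars_term l \<subseteq> vars_term r"
    by (induction rule: rtrancl_induct) (use rstep_vars[OF _ vars] in blast)+
  with vars assms(3) show ?thesis by blast
qed

lemma rstep_converse:
  assumes "(s, t) \<in> rstep ar (P\<inverse>)" "wf_rules ar P"
  shows "(t, s) \<in> rstep ar P"
  using assms(1)
proof (induction s arbitrary: t rule: measure_induct_rule[of size])
  case (less s)
  have wf: "wf_term ar t"
    using less(2) wf_rules_converse[OF assms(2)] by (rule rstep_wf_right)
  from less(2) show ?case
  proof (cases rule: rstep_cases)
    case (root l r \<sigma>)
    with wf show ?thesis by (auto intro: rstep_root)
  next
    case (arg f ss i u)
    then have "(u, ss ! i) \<in> rstep ar P"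
      by (intro less(1)) (auto simp: size_nth_term_less)
    with arg wf have "(Fun f (ss[i := u]), Fun f (ss[i := u, i := ss ! i])) \<in> rstep ar P"
      by (intro rstep_arg) auto
    with arg show ?thesis by simp
  qed
qed

theorem theorem3p18:
  fixes ar :: "'f \<Rightarrow> nat"
    and P S P' :: "('f, 'v) rule set"
  assumes "infinite (UNIV :: 'v set)"
    and "is_trs ar P" and "is_trs ar S" and "is_trs ar P'"
    and "left_linear S"
    and "reversible ar P"
    and "P' \<subseteq> P \<union> P\<inverse>"
    and "terminating_relative ar S P'"
    and "CP ar S S \<subseteq>
           (rstep ar (S \<union> P'))\<^sup>* O (par_rstep ar (P \<union> P\<inverse>))\<inverse> O ((rstep ar (S \<union> P'))\<^sup>*)\<inverse>"
    and "CP_in ar (P \<union> P\<inverse>) S = {}"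
    and "CP ar S (P \<union> P\<inverse>) \<subseteq>
           ((rstep ar (S \<union> P'))\<^sup>* O par_rstep ar (P \<union> P\<inverse>)) \<union>
           ((rstep ar (S \<union> P'))\<^sup>* O par_rstep ar (P \<union> P\<inverse>) O
              ((rstep ar (S \<union> P'))\<^sup>*)\<inverse> O (rstep ar S)\<inverse>)"
  shows "confluent ar (S \<union> P)"
proof -
  let ?E = "P \<union> P\<inverse>"
  have wfP: "wf_rules ar P" using assms(2) by (rule is_trs_wf_rules)
  then have wfE: "wf_rules ar ?E" by (intro wf_rules_Un wf_rules_converse)
  interpret reduction_preserving ar S ?E P'
  proof
    show "sym ?E" by (rule sym_Un_converse)
    show "\<forall>(l, r) \<in> ?E. vars_term r \<subseteq> vars_term l"
      using reversible_vars[OF assms(2,6)] by fastforce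
  qed (use assms wfE in auto)
  \<comment> \<open>A \<open>P\<inverse>\<close>-step is a \<open>P\<close>-step read backwards,
    which reversibility undoes by forward \<open>P\<close>-steps.\<close>
  have "rstep ar (P\<inverse>) \<subseteq> (rstep ar P)\<^sup>*"
    using rstep_converse[OF _ wfP] assms(6) by (auto simp: reversible_def)
  then have "rstep ar ?E \<subseteq> (rstep ar P)\<^sup>*"
    unfolding rstep_Un by blast
  then have "par ar ?E \<subseteq> (rstep ar P)\<^sup>*"
    using par_subset_rsteps[OF wfE] rtrancl_subset_rtrancl by blast
  also have "\<dots> \<subseteq> (rstep ar (S \<union> P))\<^sup>*"
    unfolding rstep_Un by (intro rtrancl_mono) blast
  finally have par: "(par ar ?E)\<^sup>* \<subseteq> (rstep ar (S \<union> P))\<^sup>*"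
    by (rule rtrancl_subset_rtrancl)
  have H: "(rstep ar S)\<^sup>* \<subseteq> (rstep ar (S \<union> P))\<^sup>*"
    unfolding rstep_Un by (intro rtrancl_mono) blast
  let ?C = "rstep ar S \<union> (rstep ar S)\<inverse> \<union> par ar ?E"
  have "rstep ar P \<subseteq> par ar ?E"
    using rstep_mono[of P ?E] rstep_subset_par by blast
  then have step: "rstep ar (S \<union> P) \<subseteq> ?C"
    unfolding rstep_Un by blast
  have "sym ?C"
    using symV by (auto simp: sym_def)
  show ?thesis
    unfolding confluent_def
  proof (rule subrelI)
    fix y z assume "(y, z) \<in> ((rstep ar (S \<union> P))\<^sup>*)\<inverse> O (rstep ar (S \<union> P))\<^sup>*"
    then obtain x where x: "(x, y) \<in> (rstep ar (S \<union> P))\<^sup>*" "(x, z) \<in> (rstep ar (S \<union> P))\<^sup>*"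
      by blast
    then have "(x, y) \<in> ?C\<^sup>*" "(x, z) \<in> ?C\<^sup>*"
      using rtrancl_mono[OF step] by blast+
    \<comment> \<open>Since \<open>?C\<close> is symmetric, the peak at \<open>x\<close> is a
      conversion between \<open>y\<close> and \<open>z\<close>.\<close>
    then have "(y, z) \<in> ?C\<^sup>*"
      using sym_rtrancl[OF \<open>sym ?C\<close>] by (meson rtrancl_trans symD)
    then have "(y, z) \<in> (rstep ar S)\<^sup>* O (par ar ?E)\<^sup>* O ((rstep ar S)\<inverse>)\<^sup>*"
      by (rule church_rosser)
    then obtain a b where "(y, a) \<in> (rstep ar S)\<^sup>*" "(a, b) \<in> (par ar ?E)\<^sup>*" "(z, b) \<in> (rstep ar S)\<^sup>*"
      by (auto simp: rtrancl_converse)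
    \<comment> \<open>The middle part is turned into forward \<open>P\<close>-steps and appended on
      the side of \<open>y\<close>, so that \<open>b\<close> is a common reduct.\<close>
    then have "(y, b) \<in> (rstep ar (S \<union> P))\<^sup>*" "(z, b) \<in> (rstep ar (S \<union> P))\<^sup>*"
      using H par by (auto intro: rtrancl_trans)
    then show "(y, z) \<in> (rstep ar (S \<union> P))\<^sup>* O ((rstep ar (S \<union> P))\<^sup>*)\<inverse>"
      by blast
  qed
qed

end
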